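(* For each positive integer $n$ let $\bm{X}_n = (X_{n,1}, \ldots, X_{n,k_n})$ be a random vector in $(0,\infty)^{k_n}$, where $k_n \ge 2$ are integers with $k_n \to \infty$ as $n\to\infty$. Assume that $$\lim_{n \to \infty} \Pr(X_{n,1} = \ldots = X_{n,k_n}) = 0,$$ and that there exist $0 < \alpha_- < \alpha_0 < \alpha_+ < \infty$ and a positive sequence $(\sigma_n)_{n \in \mathbb{N}}$ such that, for all $f \in \mathcal{F}_1(\alpha_-,\alpha_+)$, $$\frac{1}{k_n}\sum_{i=1}^{k_n} f(X_{n,i}/\sigma_n) \rightsquigarrow \int_0^\infty f(x)\, p_{\alpha_0,1}(x)\, \mathrm{d}x, \qquad n\to\infty.$$ Then, on the complement of the event $\{X_{n,1} = \ldots = X_{n,k_n}\}$, the random vector $(\hat\alpha_n,\hat\sigma_n)$ is the unique maximizer over $(0,\infty)^2$ of the log-likelihood $(\alpha,\sigma)\mapsto L(\alpha,\sigma \mid X_{n,1},\ldots,X_{n,k_n})$. Moreover, $$(\hat\alpha_n, \hat\sigma_n/\sigma_n) \rightsquigarrow (\alpha_0, 1), \qquad n\to\infty.$$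
   Context: The arrow $\rightsquigarrow$ denotes weak convergence (convergence in distribution). Fr\'echet family: for $\theta=(\alpha,\sigma)\in(0,\infty)^2$, the Fr\'echet distribution has cdf $\exp\{-(x/\sigma)^{-\alpha}\}$ and density $p_{\theta}(x)=p_{\alpha,\sigma}(x) = \frac{\alpha}{\sigma}\exp\{-(x/\sigma)^{-\alpha}\}(x/\sigma)^{-\alpha-1}$ for $x>0$; $\ell_\theta(x) = \log p_\theta(x)=\log(\alpha/\sigma) - (x/\sigma)^{-\alpha} - (\alpha+1)\log(x/\sigma)$. For $\bm{x} = (x_1,\ldots,x_k)\in(0,\infty)^k$ the log-likelihood is $L(\alpha,\sigma\mid \bm{x}) = \sum_{i=1}^k \ell_{(\alpha,\sigma)}(x_i)$. Function class: $\mathcal{F}_1(\alpha_-,\alpha_+) = \{x\mapsto \log x\}\cup\{x\mapsto x^{-\alpha}: \alpha_-<\alpha<\alpha_+\}\cup\{x\mapsto x^{-\alpha}\log x: \alpha_-<\alpha<\alpha_+\}$, functions from $(0,\infty)$ to $\mathbb{R}$. Estimators: let $$\Psi_k(\alpha\mid\bm{x}) = \frac1\alpha + \frac{\frac1k\sum_{i=1}^k x_i^{-\alpha}\log(x_i)}{\frac1k\sum_{i=1}^k x_i^{-\alpha}} - \frac1k\sum_{i=1}^k\log(x_i),\qquad \alpha>0.$$ If $x_1,\ldots,x_k$ are not all equal, $\alpha\mapsto\Psi_k(\alpha\mid\bm{x})$ has a unique zero in $(0,\infty)$. On the event that $X_{n,1},\ldots,X_{n,k_n}$ are not all equal, $\hat\alpha_n$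 is the unique zero of $\alpha\mapsto\Psi_{k_n}(\alpha\mid\bm{X}_n)$ and $\hat\sigma_n = \bigl(\frac1{k_n}\sum_{i=1}^{k_n}X_{n,i}^{-\hat\alpha_n}\bigr)^{-1/\hat\alpha_n}$. On the event $\{X_{n,1}=\ldots=X_{n,k_n}\}$, put $\hat\alpha_n=\infty$ and $\hat\sigma_n=X_{n,1}$. *)

theory Defs
  imports "HOL-Probability.Probability"
begin

text \<open>Samples of size \<open>k\<close> are functions \<open>x :: nat \<Rightarrow> real\<close> of which only the values at
  \<open>1, \<dots>, k\<close> matter.\<close>

definition frechet_density :: "real \<Rightarrow> real \<Rightarrow> real \<Rightarrow> real" where
  "frechet_density \<alpha> \<sigma> x =
     \<alpha> / \<sigma> * exp (- ((x / \<sigma>) powr (- \<alpha>))) * (x / \<sigma>) powr (- \<alpha> - 1)"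

definition frechet_log_likelihood :: "nat \<Rightarrow> (nat \<Rightarrow> real) \<Rightarrow> real \<Rightarrow> real \<Rightarrow> real" where
  "frechet_log_likelihood k x \<alpha> \<sigma> = (\<Sum>i=1..k. ln (frechet_density \<alpha> \<sigma> (x i)))"

text \<open>The members of this class are functions on \<open>(0,\<infinity>)\<close>; their values at nonpositive
  arguments are irrelevant.\<close>

definition F1 :: "real \<Rightarrow> real \<Rightarrow> (real \<Rightarrow> real) set" where
  "F1 a b = {\<lambda>x. ln x} \<union> {\<lambda>x. x powr (- \<alpha>) | \<alpha>. a < \<alpha> \<and> \<alpha> < b}
              \<union> {\<lambda>x. x powr (- \<alpha>) * ln x | \<alpha>. a < \<alpha> \<and> \<alpha> < b}"

definition sample_mean :: "nat \<Rightarrow> (nat \<Rightarrow> real) \<Rightarrow> real" where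
  "sample_mean k y = (\<Sum>i=1..k. y i) / real k"

definition all_equal :: "nat \<Rightarrow> (nat \<Rightarrow> real) \<Rightarrow> bool" where
  "all_equal k x \<longleftrightarrow> (\<forall>i\<in>{1..k}. x i = x 1)"

definition Psi :: "nat \<Rightarrow> (nat \<Rightarrow> real) \<Rightarrow> real \<Rightarrow> real" where
  "Psi k x \<alpha> =
     1 / \<alpha>
     + sample_mean k (\<lambda>i. x i powr (- \<alpha>) * ln (x i)) / sample_mean k (\<lambda>i. x i powr (- \<alpha>))
     - sample_mean k (\<lambda>i. ln (x i))"

definition alpha_hat :: "nat \<Rightarrow> (nat \<Rightarrow> real) \<Rightarrow> ereal" where
  "alpha_hat k x = (if all_equal k x then \<infinity> else ereal (THE \<alpha>. 0 < \<alpha> \<and> Psi k x \<alpha> = 0))"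

definition sigma_hat :: "nat \<Rightarrow> (nat \<Rightarrow> real) \<Rightarrow> real" where
  "sigma_hat k x =
     (if all_equal k x then x 1
      else let \<alpha> = real_of_ereal (alpha_hat k x)
           in sample_mean k (\<lambda>i. x i powr (- \<alpha>)) powr (- 1 / \<alpha>))"

text \<open>The library's \<^const>\<open>weak_conv_m\<close> is defined through distribution functions and so only
  covers measures on the real line. On a general space, weak convergence means convergence of
  the integrals of all bounded continuous functions; on the real line the two notions agree,
  as shown below.\<close>

definition weak_conv_bc :: "(nat \<Rightarrow> 'b::topological_space measure) \<Rightarrow> 'b measure \<Rightarrow> bool" where
  "weak_conv_bc \<mu> \<nu> \<longleftrightarrow>
     (\<forall>f :: 'b \<Rightarrow> real. continuous_on UNIV f \<and> bounded (range f) \<longrightarrow>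
        (\<lambda>n. integral\<^sup>L (\<mu> n) f) \<longlonglongrightarrow> integral\<^sup>L \<nu> f)"

lemma weak_conv_bc_iff_weak_conv_m:
  fixes \<mu> :: "nat \<Rightarrow> real measure"
  assumes "\<And>n. real_distribution (\<mu> n)" and "real_distribution \<nu>"
  shows "weak_conv_bc \<mu> \<nu> \<longleftrightarrow> weak_conv_m \<mu> \<nu>"
proof
  assume *: "weak_conv_bc \<mu> \<nu>"
  show "weak_conv_m \<mu> \<nu>"
  proof (rule integral_bdd_continuous_conv_imp_weak_conv[OF assms])
    fix f :: "real \<Rightarrow> real"
    assume "\<And>x. isCont f x" "\<And>x. \<bar>f x\<bar> \<le> 1"
    then have "continuous_on UNIV f" "bounded (range f)"
      by (auto simp: continuous_on_eq_continuous_at bounded_iff)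
    with * show "(\<lambda>n. integral\<^sup>L (\<mu> n) f) \<longlonglongrightarrow> integral\<^sup>L \<nu> f"
      by (auto simp: weak_conv_bc_def)
  qed
next
  assume *: "weak_conv_m \<mu> \<nu>"
  show "weak_conv_bc \<mu> \<nu>"
    unfolding weak_conv_bc_def
  proof (intro allI impI)
    fix f :: "real \<Rightarrow> real"
    assume f: "continuous_on UNIV f \<and> bounded (range f)"
    then obtain B where B: "\<And>x. norm (f x) \<le> B"
      by (auto simp: bounded_iff)
    have cont: "\<And>x. isCont f x"
      using f by (auto simp: continuous_on_eq_continuous_at)
    show "(\<lambda>n. integral\<^sup>L (\<mu> n) f) \<longlonglongrightarrow> integral\<^sup>L \<nu> f"
      by (rule weak_conv_imp_integral_bdd_continuous_conv[OF assms * cont B])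
  qed
qed

end

theory Submission
  imports Defs "HOL-Real_Asymp.Real_Asymp"
begin

text \<open>
  For a fixed shape \<open>\<alpha>\<close> the log-likelihood depends on the scale only through \<open>ln t - t\<close> with
  \<open>t = s\<^sup>\<alpha> \<cdot> mean (x\<^sub>i\<^sup>-\<^sup>\<alpha>)\<close>, so the best scale is the one with \<open>t = 1\<close>
  (\<open>log_likelihood_eq\<close>). What remains is the profile likelihood in \<open>\<alpha>\<close>, whose derivative is
  \<open>Psi\<close>. The middle term of \<open>Psi\<close> is a weighted mean of the \<open>ln x\<^sub>i\<close> whose weights
  favour small observations the more, the larger \<open>\<alpha>\<close> is; it is therefore decreasing
  (\<open>tilted_log_antimono\<close>), and the term \<open>1/\<alpha>\<close> makes \<open>Psi\<close> strictly decreasing. For a sample with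
  at least two distinct values \<open>Psi\<close> changes sign (\<open>Psi_zero_exists\<close>), so the profile has exactly
  one maximizer and the first claim follows.

  For consistency, rescale the sample by \<open>\<sigma> n\<close>, under which the estimators are equivariant. At every
  fixed \<open>\<alpha>\<close> in the range, \<open>Psi\<close> converges in probability to a strictly decreasing limit.
  That limit vanishes at \<open>\<alpha>0\<close>: writing \<open>Z = X\<^sup>-\<^sup>\<alpha>\<^sup>0\<close>, which is standard exponential,
  integration by parts gives \<open>E Z = 1\<close> and \<open>E (Z ln X) - E (ln X) = -1/\<alpha>0\<close>
  (\<open>frechet_neg_moment\<close>, \<open>frechet_log_moment_diff\<close>). Looking at the sign of \<open>Psi\<close> on both sides of
  \<open>\<alpha>0\<close> traps the shape estimator. The logarithm of the sample moment of order \<open>-\<alpha>\<close> has a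
  monotone derivative in \<open>\<alpha>\<close> that converges at two points around \<open>\<alpha>0\<close>; hence it is
  asymptotically Lipschitz and the random exponent can be replaced by \<open>\<alpha>0\<close>, which gives the scale.

  Convergence in probability is expressed as convergence along a filter \<open>whp M\<close> on pairs
  \<open>(n, \<omega>)\<close>. This reduces the probabilistic part to two translations, from weak convergence to a
  constant into the filter and back; between them, \<open>consistency_along_filter\<close> is a
  deterministic statement about limits.
\<close>

section \<open>Sample means\<close>

lemma sample_mean_mono:
  assumes "\<And>i. i \<in> {1..k} \<Longrightarrow> y i \<le> z i"
  shows "sample_mean k y \<le> sample_mean k z"
  unfolding sample_mean_def by (intro divide_right_mono sum_mono assms) auto

lemma sample_mean_cong:
  assumes "\<And>i. i \<in> {1..k} \<Longrightarrow> y i = z i"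
  shows "sample_mean k y = sample_mean k z"
  unfolding sample_mean_def using assms by simp

lemma sample_mean_cmult: "sample_mean k (\<lambda>i. c * y i) = c * sample_mean k y"
  unfolding sample_mean_def by (simp add: sum_distrib_left[symmetric])

lemma sample_mean_add: "sample_mean k (\<lambda>i. y i + z i) = sample_mean k y + sample_mean k z"
  unfolding sample_mean_def by (simp add: sum.distrib add_divide_distrib)

lemma sample_mean_diff: "sample_mean k (\<lambda>i. y i - z i) = sample_mean k y - sample_mean k z"
  unfolding sample_mean_def by (simp add: sum_subtractf diff_divide_distrib)

lemma sample_mean_const: "k \<ge> 1 \<Longrightarrow> sample_mean k (\<lambda>i. c) = c"
  unfolding sample_mean_def by simp

lemma le_sample_mean_times:
  assumes "i \<in> {1..k}" "\<And>j. j \<in> {1..k} \<Longrightarrow> 0 \<le> y j"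
  shows "y i \<le> real k * sample_mean k y"
proof -
  have "y i \<le> (\<Sum>j=1..k. y j)"
    using assms by (intro member_le_sum) auto
  then show ?thesis using assms(1) by (simp add: sample_mean_def)
qed

section \<open>The likelihood equation\<close>

text \<open>The functionals of the sample through which the likelihood acts. With weights proportional to
  \<open>x\<^sub>i\<^sup>-\<^sup>\<alpha>\<close>, \<open>tilted_log\<close> is the weighted mean of \<open>ln x\<^sub>i\<close>; it is also minus the derivative of
  \<open>ln (neg_moment k x \<alpha>)\<close>.\<close>

definition neg_moment :: "nat \<Rightarrow> (nat \<Rightarrow> real) \<Rightarrow> real \<Rightarrow> real" where
  "neg_moment k x \<alpha> = sample_mean k (\<lambda>i. x i powr (- \<alpha>))"

definition neg_log_moment :: "nat \<Rightarrow> (nat \<Rightarrow> real) \<Rightarrow> real \<Rightarrow> real" where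
  "neg_log_moment k x \<alpha> = sample_mean k (\<lambda>i. x i powr (- \<alpha>) * ln (x i))"

definition mean_log :: "nat \<Rightarrow> (nat \<Rightarrow> real) \<Rightarrow> real" where
  "mean_log k x = sample_mean k (\<lambda>i. ln (x i))"

definition tilted_log :: "nat \<Rightarrow> (nat \<Rightarrow> real) \<Rightarrow> real \<Rightarrow> real" where
  "tilted_log k x \<alpha> = neg_log_moment k x \<alpha> / neg_moment k x \<alpha>"

text \<open>Up to an additive constant that depends on the sample only, this is \<open>1/k\<close> times the maximum
  over \<open>s\<close> of the log-likelihood at \<open>(\<alpha>, s)\<close>; see \<open>log_likelihood_eq\<close>.\<close>

definition profile :: "nat \<Rightarrow> (nat \<Rightarrow> real) \<Rightarrow> real \<Rightarrow> real" where
  "profile k x \<alpha> = ln \<alpha> - ln (neg_moment k x \<alpha>) - \<alpha> * mean_log k x"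

lemma Psi_eq: "Psi k x \<alpha> = 1 / \<alpha> + tilted_log k x \<alpha> - mean_log k x"
  unfolding Psi_def tilted_log_def mean_log_def neg_moment_def neg_log_moment_def ..

locale positive_sample =
  fixes k :: nat and x :: "nat \<Rightarrow> real"
  assumes k_ge_1: "1 \<le> k"
    and x_pos: "\<And>i. i \<in> {1..k} \<Longrightarrow> 0 < x i"
begin

lemma neg_moment_pos: "0 < neg_moment k x \<alpha>"
  unfolding neg_moment_def sample_mean_def using k_ge_1 x_pos
  by (intro divide_pos_pos sum_pos) (auto simp: less_imp_neq[OF x_pos, symmetric])

text \<open>Jensen's inequality for the exponential function, proved by averaging its tangent at the mean.
  In the limit it bounds the negative moments of the Frechet distribution away from zero.\<close>

lemma neg_moment_ge_exp: "exp (- \<alpha> * mean_log k x) \<le> neg_moment k x \<alpha>"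
proof -
  define m where "m = - \<alpha> * mean_log k x"
  have tangent: "exp m * (1 + (u - m)) \<le> exp u" for u :: real
    using exp_ge_add_one_self[of "u - m"] by (simp add: exp_diff field_simps)
  have "exp m = sample_mean k (\<lambda>i. exp m * (1 + (- \<alpha> * ln (x i) - m)))"
    by (simp only: sample_mean_cmult sample_mean_add sample_mean_diff sample_mean_const[OF k_ge_1])
       (simp add: m_def mean_log_def)
  also have "\<dots> \<le> neg_moment k x \<alpha>"
    unfolding neg_moment_def
  proof (rule sample_mean_mono)
    fix i assume "i \<in> {1..k}"
    from x_pos[OF this] show "exp m * (1 + (- \<alpha> * ln (x i) - m)) \<le> x i powr - \<alpha>"
      using tangent[of "- \<alpha> * ln (x i)"] by (simp add: powr_def)
  qed
  finally show ?thesis by (simp add: m_def)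
qed

text \<open>As \<open>\<alpha>\<close> grows, the weights \<open>x\<^sub>i\<^sup>-\<^sup>\<alpha>\<close> shift mass to the small observations, so the weighted mean
  of the logarithms decreases. Formally this is Chebyshev's sum inequality: after clearing
  denominators and symmetrizing the double sum in \<open>i\<close> and \<open>j\<close>, each term is a product of two
  factors that have the same sign.\<close>

lemma tilted_log_antimono:
  assumes "\<alpha> \<le> \<beta>"
  shows "tilted_log k x \<beta> \<le> tilted_log k x \<alpha>"
proof -
  define w where "w a i = x i powr (- a)" for a i
  define l where "l i = ln (x i)" for i
  define I where "I = {1..k}"
  define T where "T = (\<Sum>i\<in>I. \<Sum>j\<in>I. w \<alpha> i * w \<beta> j * (l i - l j))"
  have T_swap: "T = (\<Sum>i\<in>I. \<Sum>j\<in>I. w \<alpha> j * w \<beta> i * (l j - l i))"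
    unfolding T_def by (rule sum.swap)
  have w_eq: "w a i = exp (- a * l i)" if "i \<in> I" for a i
    using x_pos[of i] that by (simp add: w_def l_def I_def powr_def)
  have term_nonneg: "0 \<le> w \<alpha> i * w \<beta> j * (l i - l j) + w \<alpha> j * w \<beta> i * (l j - l i)"
    if "i \<in> I" "j \<in> I" for i j
  proof -
    have eq: "w \<beta> i = w \<alpha> i * exp (- (\<beta> - \<alpha>) * l i)" if "i \<in> I" for i
      unfolding w_eq[OF that] mult_exp_exp by (simp add: algebra_simps)
    have "0 \<le> (l i - l j) * (exp (- (\<beta> - \<alpha>) * l j) - exp (- (\<beta> - \<alpha>) * l i))"
    proof (cases "l i \<le> l j")
      case True
      then have "(\<beta> - \<alpha>) * l i \<le> (\<beta> - \<alpha>) * l j"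
        using assms by (intro mult_left_mono) auto
      with True show ?thesis by (intro mult_nonpos_nonpos) (simp_all add: algebra_simps)
    next
      case False
      then have "(\<beta> - \<alpha>) * l j \<le> (\<beta> - \<alpha>) * l i"
        using assms by (intro mult_left_mono) auto
      with False show ?thesis by (intro mult_nonneg_nonneg) (simp_all add: algebra_simps)
    qed
    then have "0 \<le> w \<alpha> i * w \<alpha> j * ((l i - l j) * (exp (- (\<beta> - \<alpha>) * l j) - exp (- (\<beta> - \<alpha>) * l i)))"
      by (rule mult_nonneg_nonneg[rotated]) (simp add: w_def)
    then show ?thesis unfolding eq[OF that(1)] eq[OF that(2)] by (simp add: algebra_simps)
  qed
  have "2 * T = (\<Sum>i\<in>I. \<Sum>j\<in>I. w \<alpha> i * w \<beta> j * (l i - l j) + w \<alpha> j * w \<beta> i * (l j - l i))"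
    using T_swap by (simp add: sum.distrib T_def)
  also have "\<dots> \<ge> 0" by (intro sum_nonneg term_nonneg)
  finally have T_nonneg: "0 \<le> T" by simp
  have "T = (\<Sum>i\<in>I. w \<alpha> i * l i) * (\<Sum>j\<in>I. w \<beta> j) - (\<Sum>i\<in>I. w \<alpha> i) * (\<Sum>j\<in>I. w \<beta> j * l j)"
    unfolding T_def sum_product sum_subtractf[symmetric]
    by (intro sum.cong refl) (simp add: algebra_simps)
  also have "\<dots> = (real k)\<^sup>2 * (neg_log_moment k x \<alpha> * neg_moment k x \<beta>
                              - neg_moment k x \<alpha> * neg_log_moment k x \<beta>)"
    using k_ge_1 unfolding neg_log_moment_def neg_moment_def sample_mean_def
    by (simp add: w_def l_def I_def field_simps power2_eq_square)
  finally have "0 \<le> neg_log_moment k x \<alpha> * neg_moment k x \<beta>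
                     - neg_moment k x \<alpha> * neg_log_moment k x \<beta>"
    using T_nonneg k_ge_1 by (simp add: zero_le_mult_iff)
  then show ?thesis
    using neg_moment_pos[of \<alpha>] neg_moment_pos[of \<beta>] by (simp add: tilted_log_def field_simps)
qed

text \<open>This quantitative form of strict monotonicity survives passage to a limit, so it also shows
  that the limit of \<open>Psi\<close> is strictly decreasing.\<close>

lemma Psi_diff_ge: "\<alpha> \<le> \<beta> \<Longrightarrow> 1 / \<alpha> - 1 / \<beta> \<le> Psi k x \<alpha> - Psi k x \<beta>"
  using tilted_log_antimono[of \<alpha> \<beta>] by (simp add: Psi_eq)

lemma Psi_strict_antimono:
  assumes "0 < \<alpha>" "\<alpha> < \<beta>"
  shows "Psi k x \<beta> < Psi k x \<alpha>"
proof -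
  have "1 / \<beta> < 1 / \<alpha>" using assms by (intro divide_strict_left_mono) auto
  then show ?thesis using Psi_diff_ge[of \<alpha> \<beta>] assms by linarith
qed

lemma tilted_log_ge:
  assumes "\<And>i. i \<in> {1..k} \<Longrightarrow> m \<le> ln (x i)"
  shows "m \<le> tilted_log k x \<alpha>"
proof -
  have "m * neg_moment k x \<alpha> \<le> neg_log_moment k x \<alpha>"
    unfolding neg_moment_def neg_log_moment_def sample_mean_cmult[symmetric]
    using assms by (intro sample_mean_mono) (auto simp: mult.commute[of m] intro!: mult_left_mono)
  then show ?thesis using neg_moment_pos by (simp add: tilted_log_def field_simps)
qed

text \<open>When \<open>j\<close> is the index of the smallest observation, this says that for large \<open>\<alpha>\<close> the weights
  concentrate there. The rate \<open>k/\<alpha>\<close> comes from two facts: \<open>t exp (-t) \<le> 1\<close> bounds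
  every weighted excess \<open>ln x\<^sub>i - ln x\<^sub>j\<close> by the weight of \<open>x\<^sub>j\<close> divided by \<open>\<alpha>\<close>, and the weight
  of \<open>x\<^sub>j\<close> is at most the sum of all weights.\<close>

lemma tilted_log_le_min:
  assumes "0 < \<alpha>" "j \<in> {1..k}"
  shows "tilted_log k x \<alpha> \<le> ln (x j) + real k / \<alpha>"
proof -
  define m where "m = ln (x j)"
  have "neg_log_moment k x \<alpha> - m * neg_moment k x \<alpha> = sample_mean k (\<lambda>i. x i powr (- \<alpha>) * (ln (x i) - m))"
    unfolding neg_log_moment_def neg_moment_def sample_mean_cmult[symmetric] sample_mean_diff[symmetric]
    by (simp add: algebra_simps)
  also have "\<dots> \<le> sample_mean k (\<lambda>i. exp (- \<alpha> * m) / \<alpha>)"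
  proof (rule sample_mean_mono)
    fix i assume i: "i \<in> {1..k}"
    have "\<alpha> * (ln (x i) - m) \<le> exp (\<alpha> * (ln (x i) - m))"
      using exp_ge_add_one_self[of "\<alpha> * (ln (x i) - m)"] by linarith
    then have "exp (- \<alpha> * ln (x i)) * (\<alpha> * (ln (x i) - m))
        \<le> exp (- \<alpha> * ln (x i)) * exp (\<alpha> * (ln (x i) - m))"
      by (intro mult_left_mono) auto
    also have "\<dots> = exp (- \<alpha> * m)" unfolding mult_exp_exp by (simp add: algebra_simps)
    finally show "x i powr (- \<alpha>) * (ln (x i) - m) \<le> exp (- \<alpha> * m) / \<alpha>"
      using assms(1) x_pos[OF i] by (simp add: powr_def field_simps)
  qed
  also have "\<dots> = exp (- \<alpha> * m) / \<alpha>" by (rule sample_mean_const[OF k_ge_1])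
  also have "exp (- \<alpha> * m) = x j powr (- \<alpha>)"
    using x_pos[OF assms(2)] by (simp add: powr_def m_def)
  also have "x j powr (- \<alpha>) / \<alpha> \<le> real k * neg_moment k x \<alpha> / \<alpha>"
    unfolding neg_moment_def using assms(1)
    by (intro divide_right_mono le_sample_mean_times[OF assms(2)]) auto
  finally show ?thesis
    using neg_moment_pos[of \<alpha>] assms(1) by (simp add: tilted_log_def m_def[symmetric] field_simps)
qed

lemma isCont_tilted_log: "isCont (tilted_log k x) \<alpha>"
proof -
  have *: "isCont (\<lambda>\<alpha>. x i powr (- \<alpha>)) \<alpha>" if "i \<in> {1..k}" for i
    using x_pos[OF that] by (intro continuous_intros) auto
  have "isCont (neg_moment k x) \<alpha>"
    unfolding neg_moment_def[abs_def] sample_mean_def divide_inverse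
    by (intro continuous_mult continuous_sum continuous_const *)
  moreover have "isCont (neg_log_moment k x) \<alpha>"
    unfolding neg_log_moment_def[abs_def] sample_mean_def divide_inverse
    by (intro continuous_mult continuous_sum continuous_const *)
  ultimately have "isCont (\<lambda>\<alpha>. neg_log_moment k x \<alpha> / neg_moment k x \<alpha>) \<alpha>"
    using neg_moment_pos[of \<alpha>] by (intro isCont_divide) auto
  then show ?thesis by (simp add: tilted_log_def[abs_def])
qed

lemma DERIV_ln_neg_moment:
  "((\<lambda>\<alpha>. ln (neg_moment k x \<alpha>)) has_real_derivative - tilted_log k x \<alpha>) (at \<alpha>)"
proof -
  have *: "((\<lambda>\<alpha>. x i powr (- \<alpha>)) has_real_derivative - (x i powr (- \<alpha>) * ln (x i))) (at \<alpha>)"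
    if "i \<in> {1..k}" for i
    using x_pos[OF that] by (auto intro!: derivative_eq_intros simp: powr_def)
  have "(neg_moment k x has_real_derivative (\<Sum>i=1..k. - (x i powr (- \<alpha>) * ln (x i))) / real k) (at \<alpha>)"
    unfolding neg_moment_def[abs_def] sample_mean_def
    by (intro DERIV_cdivide DERIV_sum *)
  then have "(neg_moment k x has_real_derivative - neg_log_moment k x \<alpha>) (at \<alpha>)"
    by (simp add: neg_log_moment_def sample_mean_def sum_negf)
  from DERIV_chain2[OF DERIV_ln_divide[OF neg_moment_pos] this] show ?thesis
    by (simp add: tilted_log_def)
qed

text \<open>The derivative \<open>-tilted_log\<close> is monotone, so on an interval its values at the two end points
  bound it. This controls the moment at a data-dependent exponent by quantities at two fixed
  exponents.\<close>

lemma ln_neg_moment_Lipschitz: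
  assumes "u \<in> {a..b}" "v \<in> {a..b}"
  shows "\<bar>ln (neg_moment k x u) - ln (neg_moment k x v)\<bar>
           \<le> (\<bar>tilted_log k x a\<bar> + \<bar>tilted_log k x b\<bar>) * \<bar>u - v\<bar>"
proof -
  have "norm (ln (neg_moment k x u) - ln (neg_moment k x v))
          \<le> (\<bar>tilted_log k x a\<bar> + \<bar>tilted_log k x b\<bar>) * norm (u - v)"
  proof (rule field_differentiable_bound[where S = "{a..b}"])
    fix z assume z: "z \<in> {a..b}"
    show "((\<lambda>\<alpha>. ln (neg_moment k x \<alpha>)) has_real_derivative - tilted_log k x z) (at z within {a..b})"
      by (rule has_field_derivative_at_within[OF DERIV_ln_neg_moment])
    show "norm (- tilted_log k x z) \<le> \<bar>tilted_log k x a\<bar> + \<bar>tilted_log k x b\<bar>"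
      using tilted_log_antimono[of a z] tilted_log_antimono[of z b] z by auto
  qed (use assms in auto)
  then show ?thesis by simp
qed

lemma DERIV_profile:
  assumes "0 < \<alpha>"
  shows "(profile k x has_real_derivative Psi k x \<alpha>) (at \<alpha>)"
proof -
  have "(profile k x has_real_derivative 1 / \<alpha> - - tilted_log k x \<alpha> - 1 * mean_log k x) (at \<alpha>)"
    unfolding profile_def[abs_def]
    by (intro DERIV_diff DERIV_ln_neg_moment DERIV_ln_divide[OF assms] DERIV_cmult_right DERIV_ident)
  then show ?thesis by (simp add: Psi_eq)
qed

text \<open>The profile has derivative \<open>Psi\<close>, which changes sign from plus to minus at its zero.\<close>

lemma profile_less:
  assumes "0 < a" "Psi k x a = 0" "0 < \<alpha>" "\<alpha> \<noteq> a"
  shows "profile k x \<alpha> < profile k x a"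
proof (cases "\<alpha> < a")
  case True
  then obtain z where z: "\<alpha> < z" "z < a" "profile k x a - profile k x \<alpha> = (a - \<alpha>) * Psi k x z"
    using MVT2[of \<alpha> a "profile k x" "Psi k x"] DERIV_profile assms(3) by fastforce
  then have "0 < Psi k x z" using Psi_strict_antimono[of z a] assms by auto
  with z True show ?thesis by (smt (verit) mult_pos_pos)
next
  case False
  with assms(4) have "a < \<alpha>" by simp
  then obtain z where z: "a < z" "z < \<alpha>" "profile k x \<alpha> - profile k x a = (\<alpha> - a) * Psi k x z"
    using MVT2[of a \<alpha> "profile k x" "Psi k x"] DERIV_profile assms(1) by fastforce
  then have "Psi k x z < 0" using Psi_strict_antimono[of a z] assms by auto
  with z \<open>a < \<alpha>\<close> show ?thesis by (smt (verit) mult_pos_neg)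
qed

text \<open>For fixed \<open>\<alpha>\<close> the scale enters only through \<open>t = s\<^sup>\<alpha> \<cdot> neg_moment k x \<alpha>\<close>, in the term
  \<open>ln t - t\<close>, which is largest exactly at \<open>t = 1\<close>. The two parameters are thereby separated.\<close>

lemma log_likelihood_eq:
  assumes "0 < \<alpha>" "0 < s"
  shows "frechet_log_likelihood k x \<alpha> s =
     real k * (profile k x \<alpha> - mean_log k x
               + (ln (s powr \<alpha> * neg_moment k x \<alpha>) - s powr \<alpha> * neg_moment k x \<alpha>))"
proof -
  have "ln (frechet_density \<alpha> s (x i)) =
      ln \<alpha> + \<alpha> * ln s - s powr \<alpha> * x i powr (- \<alpha>) - (\<alpha> + 1) * ln (x i)" if "i \<in> {1..k}" for i
    using x_pos[OF that] assms
    by (simp add: frechet_density_def ln_mult ln_div ln_powr powr_divide powr_minus field_simps)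
  then have "frechet_log_likelihood k x \<alpha> s =
      (\<Sum>i=1..k. ln \<alpha> + \<alpha> * ln s - s powr \<alpha> * x i powr (- \<alpha>) - (\<alpha> + 1) * ln (x i))"
    by (simp add: frechet_log_likelihood_def)
  also have "\<dots> = real k * sample_mean k (\<lambda>i. ln \<alpha> + \<alpha> * ln s - s powr \<alpha> * x i powr (- \<alpha>) - (\<alpha> + 1) * ln (x i))"
    using k_ge_1 by (simp add: sample_mean_def)
  also have "\<dots> = real k * (ln \<alpha> + \<alpha> * ln s - s powr \<alpha> * neg_moment k x \<alpha> - (\<alpha> + 1) * mean_log k x)"
    by (simp add: sample_mean_diff sample_mean_cmult sample_mean_const[OF k_ge_1] neg_moment_def mean_log_def)
  also have "\<dots> = real k * (profile k x \<alpha> - mean_log k x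
               + (ln (s powr \<alpha> * neg_moment k x \<alpha>) - s powr \<alpha> * neg_moment k x \<alpha>))"
    using assms neg_moment_pos[of \<alpha>] by (simp add: profile_def ln_mult ln_powr algebra_simps)
  finally show ?thesis .
qed

end

section \<open>The unique maximizer of the likelihood\<close>

locale nonconstant_sample = positive_sample +
  assumes not_all_equal: "\<not> all_equal k x"
begin

text \<open>With \<open>m\<close> the smallest \<open>ln x\<^sub>i\<close> and \<open>d > 0\<close> its distance to the mean of the logarithms,
  \<open>1/\<alpha> - d \<le> Psi k x \<alpha> \<le> (1 + k)/\<alpha> - d\<close>. The two bounds vanish at \<open>1/d\<close> and at \<open>(k + 1)/d\<close>,
  and the intermediate value theorem applies between these points.\<close>

lemma Psi_zero_exists: "\<exists>a>0. Psi k x a = 0"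
proof -
  define m where "m = Min ((\<lambda>i. ln (x i)) ` {1..k})"
  have m_le: "m \<le> ln (x i)" if "i \<in> {1..k}" for i
    unfolding m_def using that by (intro Min_le) auto
  have "m \<in> (\<lambda>i. ln (x i)) ` {1..k}" unfolding m_def using k_ge_1 by (intro Min_in) auto
  then obtain j where j: "j \<in> {1..k}" "m = ln (x j)" by blast
  have m_less: "m < mean_log k x"
  proof -
    have "\<exists>i\<in>{1..k}. m < ln (x i)"
    proof (rule ccontr)
      assume "\<not> ?thesis"
      then have "ln (x i) = m" if "i \<in> {1..k}" for i using m_le[OF that] that by force
      then have "x i = exp m" if "i \<in> {1..k}" for i using x_pos[OF that] that by (metis exp_ln)
      then have "all_equal k x" using k_ge_1 by (auto simp: all_equal_def)
      with not_all_equal show False by simp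
    qed
    then have "(\<Sum>i=1..k. m) < (\<Sum>i=1..k. ln (x i))"
      using m_le by (intro sum_strict_mono_ex1) auto
    then show ?thesis using k_ge_1 by (simp add: mean_log_def sample_mean_def field_simps)
  qed
  define d where "d = mean_log k x - m"
  have d: "0 < d" using m_less by (simp add: d_def)
  have lo: "0 \<le> Psi k x (1 / d)"
    using tilted_log_ge[of m "1 / d"] m_le d by (auto simp: Psi_eq d_def)
  have hi: "Psi k x ((real k + 1) / d) \<le> 0"
    using tilted_log_le_min[of "(real k + 1) / d" j] j d
    by (simp add: Psi_eq d_def) (simp add: field_simps)
  have "\<exists>a. 1 / d \<le> a \<and> a \<le> (real k + 1) / d \<and> Psi k x a = 0"
  proof (rule IVT2[where f = "Psi k x", OF hi lo])
    show "1 / d \<le> (real k + 1) / d" using d by (simp add: field_simps)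
    show "\<forall>a. 1 / d \<le> a \<and> a \<le> (real k + 1) / d \<longrightarrow> isCont (Psi k x) a"
      unfolding Psi_eq[abs_def]
    proof (intro allI impI)
      fix a assume "1 / d \<le> a \<and> a \<le> (real k + 1) / d"
      then have "a \<noteq> 0" using d by (smt (verit) zero_less_divide_1_iff)
      then show "isCont (\<lambda>\<alpha>. 1 / \<alpha> + tilted_log k x \<alpha> - mean_log k x) a"
        by (intro continuous_intros isCont_tilted_log) auto
    qed
  qed
  then show ?thesis using d by (smt (verit) zero_less_divide_1_iff)
qed

abbreviation a_hat :: real where "a_hat \<equiv> real_of_ereal (alpha_hat k x)"

lemma a_hat: "0 < a_hat" "Psi k x a_hat = 0" "alpha_hat k x = ereal a_hat"
proof -
  have "\<exists>!a. 0 < a \<and> Psi k x a = 0"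
    using Psi_zero_exists Psi_strict_antimono by (metis less_irrefl linorder_neqE_linordered_idom)
  from theI'[OF this] show "0 < a_hat" "Psi k x a_hat = 0" "alpha_hat k x = ereal a_hat"
    using not_all_equal by (auto simp: alpha_hat_def)
qed

text \<open>Comparing the estimator with a constant amounts to reading off the sign of \<open>Psi\<close> there. Both
  consistency and measurability of the estimator rest on this, since \<open>Psi k x c\<close> is an explicit
  function of sample means.\<close>

lemma Psi_sign:
  assumes "0 < c"
  shows "0 < Psi k x c \<longleftrightarrow> c < a_hat" "Psi k x c < 0 \<longleftrightarrow> a_hat < c"
  using Psi_strict_antimono[of c a_hat] Psi_strict_antimono[of a_hat c] a_hat assms
  by (cases c a_hat rule: linorder_cases; force)+

lemma sigma_hat_eq: "sigma_hat k x = neg_moment k x a_hat powr (- 1 / a_hat)"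
  using not_all_equal by (simp add: sigma_hat_def neg_moment_def Let_def)

lemma sigma_hat_pos: "0 < sigma_hat k x"
  unfolding sigma_hat_eq using neg_moment_pos[of a_hat] by simp

lemma log_likelihood_less:
  assumes "0 < \<alpha>" "0 < s" "(\<alpha>, s) \<noteq> (a_hat, sigma_hat k x)"
  shows "frechet_log_likelihood k x \<alpha> s < frechet_log_likelihood k x a_hat (sigma_hat k x)"
proof -
  define t where "t = s powr \<alpha> * neg_moment k x \<alpha>"
  have t: "0 < t" using assms neg_moment_pos[of \<alpha>] by (simp add: t_def)
  have hat: "sigma_hat k x powr a_hat * neg_moment k x a_hat = 1"
    unfolding sigma_hat_eq powr_powr using neg_moment_pos[of a_hat] a_hat(1)
    by (simp add: powr_neg_one)
  have "profile k x \<alpha> + (ln t - t) < profile k x a_hat - 1"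
  proof (cases "\<alpha> = a_hat")
    case True
    have "t \<noteq> 1"
    proof
      assume "t = 1"
      then have "s powr a_hat = sigma_hat k x powr a_hat"
        using hat neg_moment_pos[of a_hat] by (simp add: t_def True) (metis mult_right_cancel less_irrefl)
      then have "(s powr a_hat) powr (1 / a_hat) = (sigma_hat k x powr a_hat) powr (1 / a_hat)"
        by simp
      then have "s = sigma_hat k x"
        using a_hat(1) assms(2) sigma_hat_pos by (simp add: powr_powr)
      with True assms(3) show False by simp
    qed
    then have "ln t < t - 1" using ln_le_minus_one[OF t] ln_eq_minus_one[OF t] by force
    with True show ?thesis by simp
  next
    case False
    then show ?thesis
      using profile_less[of a_hat \<alpha>] a_hat assms ln_le_minus_one[OF t] by fastforce
  qed
  then show ?thesis
    using k_ge_1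
    unfolding log_likelihood_eq[OF assms(1,2)] log_likelihood_eq[OF a_hat(1) sigma_hat_pos] hat t_def
    by (intro mult_strict_left_mono) auto
qed

lemma is_arg_max_log_likelihood:
  "is_arg_max (\<lambda>(\<alpha>, s). frechet_log_likelihood k x \<alpha> s) (\<lambda>\<theta>. \<theta> \<in> {0<..} \<times> {0<..}) \<theta>
     \<longleftrightarrow> \<theta> = (a_hat, sigma_hat k x)"
proof
  assume *: "is_arg_max (\<lambda>(\<alpha>, s). frechet_log_likelihood k x \<alpha> s) (\<lambda>\<theta>. \<theta> \<in> {0<..} \<times> {0<..}) \<theta>"
  show "\<theta> = (a_hat, sigma_hat k x)"
  proof (rule ccontr)
    assume neq: "\<theta> \<noteq> (a_hat, sigma_hat k x)"
    obtain \<alpha> s where \<theta>: "\<theta> = (\<alpha>, s)" by force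
    with * neq have "frechet_log_likelihood k x \<alpha> s < frechet_log_likelihood k x a_hat (sigma_hat k x)"
      by (intro log_likelihood_less) (auto simp: is_arg_max_def)
    with * \<theta> a_hat(1) sigma_hat_pos show False by (auto simp: is_arg_max_def)
  qed
next
  assume "\<theta> = (a_hat, sigma_hat k x)"
  then show "is_arg_max (\<lambda>(\<alpha>, s). frechet_log_likelihood k x \<alpha> s) (\<lambda>\<theta>. \<theta> \<in> {0<..} \<times> {0<..}) \<theta>"
    using a_hat(1) sigma_hat_pos log_likelihood_less
    by (auto simp: is_arg_max_def) (metis less_asym less_irrefl)
qed

end

section \<open>Scale equivariance\<close>

lemma Psi_scale:
  assumes "positive_sample k x" "0 < s"
  shows "Psi k (\<lambda>i. x i / s) \<alpha> = Psi k x \<alpha>"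
proof -
  interpret positive_sample k x by fact
  have powr: "(x i / s) powr (- \<alpha>) = s powr \<alpha> * x i powr (- \<alpha>)" if "i \<in> {1..k}" for i
    using x_pos[OF that] assms(2) by (simp add: powr_divide powr_minus field_simps)
  have ln: "ln (x i / s) = ln (x i) - ln s" if "i \<in> {1..k}" for i
    using x_pos[OF that] assms(2) by (simp add: ln_div)
  have "neg_moment k (\<lambda>i. x i / s) \<alpha> = s powr \<alpha> * neg_moment k x \<alpha>"
    unfolding neg_moment_def sample_mean_cmult[symmetric] by (intro sample_mean_cong powr)
  moreover have "neg_log_moment k (\<lambda>i. x i / s) \<alpha>
      = s powr \<alpha> * (neg_log_moment k x \<alpha> - ln s * neg_moment k x \<alpha>)"
    unfolding neg_log_moment_def neg_moment_def sample_mean_cmult[symmetric] sample_mean_diff[symmetric]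
    by (intro sample_mean_cong) (simp add: powr ln algebra_simps)
  moreover have "mean_log k (\<lambda>i. x i / s) = mean_log k x - ln s"
    unfolding mean_log_def using sample_mean_const[OF k_ge_1, of "ln s"]
    by (metis (no_types, lifting) ln sample_mean_cong sample_mean_diff)
  ultimately show ?thesis
    unfolding Psi_eq tilted_log_def
    using neg_moment_pos[of \<alpha>] assms(2) by (simp add: diff_divide_distrib)
qed

lemma all_equal_scale: "0 < s \<Longrightarrow> all_equal k (\<lambda>i. x i / s) \<longleftrightarrow> all_equal k x"
  by (simp add: all_equal_def)

lemma alpha_hat_scale:
  assumes "positive_sample k x" "0 < s"
  shows "alpha_hat k (\<lambda>i. x i / s) = alpha_hat k x"
  unfolding alpha_hat_def Psi_scale[OF assms] all_equal_scale[OF assms(2)] ..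

lemma sigma_hat_scale:
  assumes "nonconstant_sample k x" "0 < s"
  shows "sigma_hat k (\<lambda>i. x i / s) = sigma_hat k x / s"
proof -
  interpret nonconstant_sample k x by fact
  interpret scaled: nonconstant_sample k "\<lambda>i. x i / s"
    using x_pos k_ge_1 not_all_equal assms(2) by unfold_locales (auto simp: all_equal_scale)
  have hat_eq: "scaled.a_hat = a_hat"
    by (simp add: alpha_hat_scale[OF positive_sample_axioms assms(2)])
  have "(x i / s) powr (- a_hat) = s powr a_hat * x i powr (- a_hat)" if "i \<in> {1..k}" for i
    using x_pos[OF that] assms(2) by (simp add: powr_divide powr_minus field_simps)
  then have "neg_moment k (\<lambda>i. x i / s) a_hat = s powr a_hat * neg_moment k x a_hat"
    unfolding neg_moment_def sample_mean_cmult[symmetric] by (intro sample_mean_cong)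
  then show ?thesis
    unfolding sigma_hat_eq scaled.sigma_hat_eq hat_eq
    using neg_moment_pos[of a_hat] a_hat(1) assms(2)
    by (simp add: powr_mult powr_powr powr_minus field_simps)
qed

section \<open>Moments of the Frechet distribution\<close>

lemma one_plus_cube_le_exp:
  fixes z :: real
  assumes "0 \<le> z"
  shows "(1 + z) ^ 3 \<le> 27 * exp z"
proof -
  have "(1 + z) ^ 3 \<le> (3 * (1 + z / 3)) ^ 3"
    using assms by (intro power_mono) auto
  also have "\<dots> = 27 * (1 + z / 3) ^ 3" unfolding power_mult_distrib by simp
  also have "(1 + z / 3) ^ 3 \<le> exp (z / 3) ^ 3"
    using assms by (intro power_mono) auto
  also have "exp (z / 3) ^ 3 = exp z" by (simp flip: exp_of_nat_mult)
  finally show ?thesis by simp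
qed

text \<open>Both \<open>ln r \<le> r\<close> and \<open>- ln r \<le> 1/r\<close> are used with \<open>r = sqrt z\<close>, so that the factor \<open>sqrt z\<close>
  absorbs the singularity of the logarithm at zero.\<close>

lemma sqrt_mult_abs_ln_le:
  fixes z :: real
  assumes "0 < z"
  shows "sqrt z * \<bar>ln z\<bar> \<le> 2 * (1 + z)"
proof -
  define r where "r = sqrt z"
  have r: "0 < r" "r * r = z" using assms by (auto simp: r_def)
  have ln_z: "ln z = 2 * ln r" using r ln_mult[of r r] by simp
  have "ln r \<le> r - 1" using r by (intro ln_le_minus_one)
  then have "r * ln r \<le> r * r" using r by (intro mult_left_mono) auto
  moreover have "- ln r \<le> 1 / r" using ln_le_minus_one[of "1 / r"] r by (simp add: ln_div)
  then have "r * (- ln r) \<le> r * (1 / r)" using r by (intro mult_left_mono) auto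
  moreover have "0 \<le> r * r" by simp
  ultimately have "r * \<bar>ln r\<bar> \<le> 1 + r * r" using r by (auto simp: abs_if)
  then show ?thesis using r by (simp add: ln_z r_def[symmetric] abs_mult)
qed

lemma einterval_0_infinity: "einterval 0 \<infinity> = {0::real<..}"
  by (auto simp: einterval_def zero_ereal_def)

lemma at_right_0_comp:
  "((F \<circ> real_of_ereal) \<longlongrightarrow> L) (at_right (0::ereal)) \<longleftrightarrow> (F \<longlongrightarrow> L) (at_right 0)"
  unfolding zero_ereal_def by (rule ereal_tendsto_simps1)

lemma DERIV_powr_neg: "0 < x \<Longrightarrow> ((\<lambda>x. x powr (- c)) has_real_derivative - c * (x powr (- c) / x)) (at x)"
  by (auto intro!: derivative_eq_intros simp: powr_diff)

lemma LBINT_eq_interval: "(LBINT x:{0<..}. f x) = (LBINT x=0..\<infinity>. f x)" for f :: "real \<Rightarrow> real"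
  by (simp add: interval_lebesgue_integral_def einterval_0_infinity)

context
  fixes a :: real
  assumes a_pos: "0 < a"
begin

lemma frechet_density_1: "0 < x \<Longrightarrow> frechet_density a 1 x = a * exp (- (x powr (- a))) * (x powr (- a) / x)"
  by (simp add: frechet_density_def powr_diff)

text \<open>In terms of \<open>z = x\<^sup>-\<^sup>a\<close>, which has the standard exponential distribution when \<open>x\<close> is Frechet
  distributed with shape \<open>a\<close>, this is \<open>sqrt z / (x (1 + z))\<close>, the derivative of
  \<open>-(2/a) arctan (sqrt z)\<close>. Its elementary and bounded primitive makes it a convenient integrable
  majorant at both ends of the half line.\<close>

definition dominating :: "real \<Rightarrow> real" where
  "dominating x = sqrt (x powr (- a)) / (x * (1 + x powr (- a)))"

lemma dominating_integrable: "set_integrable lborel {0<..} dominating"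
proof -
  have "set_integrable lborel (einterval 0 \<infinity>) dominating"
  proof (rule interval_integral_FTC_nonneg(1))
    fix x :: real assume "0 < ereal x"
    then have x: "0 < x" by simp
    have sqrt_z: "sqrt (x powr (- a)) = x powr (- (a / 2))"
      using x by (simp add: powr_half_sqrt[symmetric] powr_powr)
    have sq: "(x powr (- (a / 2)))\<^sup>2 = x powr (- a)"
      using x by (simp add: powr_power)
    have "((\<lambda>x. - (2 / a) * arctan (x powr (- (a / 2)))) has_real_derivative
        - (2 / a) * (inverse (1 + (x powr (- (a / 2)))\<^sup>2) * (- (a / 2) * (x powr (- (a / 2)) / x)))) (at x)"
      by (intro DERIV_cmult DERIV_chain2[OF DERIV_arctan] DERIV_powr_neg x)
    moreover have "- (2 / a) * (inverse (1 + (x powr (- (a / 2)))\<^sup>2) * (- (a / 2) * (x powr (- (a / 2)) / x)))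
        = dominating x"
    proof -
      define u p where "u = 1 + x powr (- a)" and "p = x powr (- (a / 2))"
      have "u \<noteq> 0" unfolding u_def by (smt (verit) powr_ge_zero)
      then show ?thesis
        unfolding sq dominating_def sqrt_z
        unfolding u_def[symmetric] p_def[symmetric]
        using a_pos x by (simp add: field_simps)
    qed
    ultimately show "((\<lambda>x. - (2 / a) * arctan (x powr (- (a / 2)))) has_real_derivative dominating x) (at x)"
      by simp
    have "1 + x powr (- a) \<noteq> 0" by (smt (verit) powr_ge_zero)
    then show "isCont dominating x"
      unfolding dominating_def[abs_def] using x by (intro continuous_intros) auto
  next
    show "(((\<lambda>x. - (2 / a) * arctan (x powr (- (a / 2)))) \<circ> real_of_ereal) \<longlongrightarrow> - (2 / a) * (pi / 2)) (at_right 0)"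
      unfolding at_right_0_comp using a_pos by real_asymp
    show "(((\<lambda>x. - (2 / a) * arctan (x powr (- (a / 2)))) \<circ> real_of_ereal) \<longlongrightarrow> 0) (at_left \<infinity>)"
      unfolding ereal_tendsto_simps1 using a_pos by real_asymp
  qed (auto simp: dominating_def)
  then show ?thesis by (simp add: einterval_0_infinity)
qed

text \<open>Since \<open>a \<bar>ln x\<bar> = \<bar>ln z\<bar>\<close>, the factor \<open>sqrt z (1 + \<bar>ln x\<bar>)\<close> is at most a multiple of \<open>1 + z\<close>; the
  powers of \<open>1 + z\<close> that accumulate in this way number three and are swallowed by \<open>exp (-z)\<close>.\<close>

lemma moment_bound_dominating:
  assumes x: "0 < x" and q: "\<bar>q\<bar> \<le> (1 + x powr (- a)) * (1 + \<bar>ln x\<bar>)"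
  shows "\<bar>q * frechet_density a 1 x\<bar> \<le> 27 * (a + 2) * dominating x"
proof -
  define z where "z = x powr (- a)"
  have z: "0 < z" using x by (simp add: z_def)
  have ln_z: "ln z = - a * ln x" using x by (simp add: z_def ln_powr)
  have "\<bar>ln x\<bar> = \<bar>ln z\<bar> / a" using a_pos by (simp add: ln_z abs_mult)
  then have "a * (sqrt z * (1 + \<bar>ln x\<bar>)) = a * sqrt z + sqrt z * \<bar>ln z\<bar>"
    using a_pos by (simp add: field_simps)
  also have "\<dots> \<le> a * (1 + z) + 2 * (1 + z)"
  proof (intro add_mono mult_left_mono sqrt_mult_abs_ln_le z)
    show "sqrt z \<le> 1 + z"
      using z by (intro real_le_lsqrt) (auto simp: power2_eq_square algebra_simps)
  qed (use a_pos in auto)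
  finally have log_part: "a * (sqrt z * (1 + \<bar>ln x\<bar>)) \<le> (a + 2) * (1 + z)" by (simp add: algebra_simps)
  have sqrt_sq: "z = sqrt z * sqrt z" using z by simp
  have fd: "frechet_density a 1 x = a * exp (- z) * (z / x)"
    using frechet_density_1[OF x] by (simp add: z_def)
  have "\<bar>q * frechet_density a 1 x\<bar> = \<bar>q\<bar> * (a * exp (- z) * (z / x))"
    using a_pos z x by (simp add: fd abs_mult)
  also have "\<dots> \<le> ((1 + z) * (1 + \<bar>ln x\<bar>)) * (a * exp (- z) * (z / x))"
    using q a_pos z x by (intro mult_right_mono) (auto simp: z_def)
  also have "\<dots> = (1 + z) * (a * (sqrt z * (1 + \<bar>ln x\<bar>))) * (exp (- z) * (sqrt z / x))"
    by (subst (2) sqrt_sq) (simp add: mult_ac)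
  also have "\<dots> \<le> (1 + z) * ((a + 2) * (1 + z)) * (exp (- z) * (sqrt z / x))"
    using z x by (intro mult_right_mono mult_left_mono log_part) auto
  also have "\<dots> = (a + 2) * ((1 + z) ^ 3 * exp (- z)) * (sqrt z / (x * (1 + z)))"
  proof -
    define u where "u = 1 + z"
    have "u \<noteq> 0" using z by (simp add: u_def)
    then show ?thesis unfolding u_def[symmetric] using x by (simp add: field_simps power3_eq_cube)
  qed
  also have "\<dots> \<le> (a + 2) * 27 * (sqrt z / (x * (1 + z)))"
    using one_plus_cube_le_exp[of z] z x a_pos
    by (intro mult_right_mono mult_left_mono) (auto simp: exp_minus field_simps)
  also have "\<dots> = 27 * (a + 2) * dominating x" by (simp add: dominating_def z_def)
  finally show ?thesis .
qed

lemma frechet_set_integrable: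
  assumes [measurable]: "q \<in> borel_measurable borel"
    and q: "\<And>x. 0 < x \<Longrightarrow> \<bar>q x\<bar> \<le> (1 + x powr (- a)) * (1 + \<bar>ln x\<bar>)"
  shows "set_integrable lborel {0<..} (\<lambda>x. q x * frechet_density a 1 x)"
proof (rule set_integrable_bound)
  show "set_integrable lborel {0<..} (\<lambda>x. 27 * (a + 2) * dominating x)"
    by (intro set_integrable_mult_right dominating_integrable)
  show "AE x in lborel. x \<in> {0<..} \<longrightarrow> norm (q x * frechet_density a 1 x) \<le> norm (27 * (a + 2) * dominating x)"
  proof (intro AE_I2 impI)
    fix x :: real assume "x \<in> {0<..}"
    then have "\<bar>q x * frechet_density a 1 x\<bar> \<le> 27 * (a + 2) * dominating x"
      by (intro moment_bound_dominating q) auto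
    then show "norm (q x * frechet_density a 1 x) \<le> norm (27 * (a + 2) * dominating x)"
      by simp
  qed
  show "set_borel_measurable lborel {0<..} (\<lambda>x. q x * frechet_density a 1 x)"
    unfolding set_borel_measurable_def frechet_density_def by measurable
qed

lemma isCont_frechet_density: "0 < x \<Longrightarrow> isCont (frechet_density a 1) x"
  unfolding frechet_density_def[abs_def] by (intro continuous_intros) auto

text \<open>In terms of \<open>z = x\<^sup>-\<^sup>a\<close> this is the mean of the standard exponential distribution;
  \<open>(1 + z) exp (-z)\<close> is a primitive of the integrand as a function of \<open>x\<close>.\<close>

lemma frechet_neg_moment:
  "(LBINT x:{0<..}. x powr (- a) * frechet_density a 1 x) = 1"
proof -
  have "(LBINT x=0..\<infinity>. x powr (- a) * frechet_density a 1 x) = 1 - 0"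
  proof (rule interval_integral_FTC_nonneg(2))
    fix x :: real assume "0 < ereal x"
    then have x: "0 < x" by simp
    define z where "z = x powr (- a)"
    have "((\<lambda>x. (1 + x powr (- a)) * exp (- (x powr (- a)))) has_real_derivative
        (0 + - a * (z / x)) * exp (- z) + exp (- z) * - (- a * (z / x)) * (1 + z)) (at x)"
      unfolding z_def
      by (intro DERIV_mult DERIV_add DERIV_const DERIV_powr_neg[OF x] DERIV_chain2[OF DERIV_exp] DERIV_minus)
    also have "(0 + - a * (z / x)) * exp (- z) + exp (- z) * - (- a * (z / x)) * (1 + z)
        = x powr (- a) * frechet_density a 1 x"
      unfolding frechet_density_1[OF x] z_def by (simp add: algebra_simps add_divide_distrib)
    finally show "((\<lambda>x. (1 + x powr (- a)) * exp (- (x powr (- a)))) has_real_derivative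
        x powr (- a) * frechet_density a 1 x) (at x)" .
    show "isCont (\<lambda>x. x powr (- a) * frechet_density a 1 x) x"
      using x by (intro continuous_intros isCont_frechet_density) auto
  next
    show "(((\<lambda>x. (1 + x powr (- a)) * exp (- (x powr (- a)))) \<circ> real_of_ereal) \<longlongrightarrow> 0) (at_right 0)"
      unfolding at_right_0_comp using a_pos by real_asymp
    show "(((\<lambda>x. (1 + x powr (- a)) * exp (- (x powr (- a)))) \<circ> real_of_ereal) \<longlongrightarrow> 1) (at_left \<infinity>)"
      unfolding ereal_tendsto_simps1 using a_pos by real_asymp
  qed (use a_pos in \<open>auto simp: frechet_density_def\<close>)
  then show ?thesis by (simp add: LBINT_eq_interval)
qed

text \<open>The individual integrals involve Euler's constant, but the difference is elementary:
  \<open>(z - 1)\<close> times the density is the derivative in \<open>x\<close> of \<open>z exp (-z)\<close>, so integration by parts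
  against \<open>ln x\<close> leaves \<open>z exp (-z) / x\<close>, the derivative of \<open>exp (-z) / a\<close>. Integrability of both
  parts is needed to merge the integrals and to apply the fundamental theorem of calculus.\<close>

lemma frechet_log_moment_diff:
  "(LBINT x:{0<..}. x powr (- a) * ln x * frechet_density a 1 x)
     - (LBINT x:{0<..}. ln x * frechet_density a 1 x) = - 1 / a"
proof -
  define F where "F x = x powr (- a) * exp (- (x powr (- a))) * ln x - exp (- (x powr (- a))) / a" for x :: real
  have int1: "set_integrable lborel {0<..} (\<lambda>x. x powr (- a) * ln x * frechet_density a 1 x)"
  proof (rule frechet_set_integrable)
    fix x :: real assume "0 < x"
    have "x powr (- a) * \<bar>ln x\<bar> \<le> (1 + x powr (- a)) * (1 + \<bar>ln x\<bar>)"
      by (intro mult_mono) auto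
    then show "\<bar>x powr (- a) * ln x\<bar> \<le> (1 + x powr (- a)) * (1 + \<bar>ln x\<bar>)"
      by (simp add: abs_mult)
  qed measurable
  have int2: "set_integrable lborel {0<..} (\<lambda>x. ln x * frechet_density a 1 x)"
  proof (rule frechet_set_integrable)
    fix x :: real assume "0 < x"
    have "1 * \<bar>ln x\<bar> \<le> (1 + x powr (- a)) * (1 + \<bar>ln x\<bar>)"
      by (intro mult_mono) auto
    then show "\<bar>ln x\<bar> \<le> (1 + x powr (- a)) * (1 + \<bar>ln x\<bar>)"
      by simp
  qed measurable
  have "(LBINT x:{0<..}. x powr (- a) * ln x * frechet_density a 1 x)
     - (LBINT x:{0<..}. ln x * frechet_density a 1 x)
     = (LBINT x:{0<..}. x powr (- a) * ln x * frechet_density a 1 x - ln x * frechet_density a 1 x)"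
    using set_integral_diff(2)[OF int1 int2] by simp
  also have "\<dots> = (LBINT x=0..\<infinity>. x powr (- a) * ln x * frechet_density a 1 x - ln x * frechet_density a 1 x)"
    by (rule LBINT_eq_interval)
  also have "\<dots> = - 1 / a - 0"
  proof (rule interval_integral_FTC_integrable)
    show "set_integrable lborel (einterval 0 \<infinity>)
        (\<lambda>x. x powr (- a) * ln x * frechet_density a 1 x - ln x * frechet_density a 1 x)"
      unfolding einterval_0_infinity by (rule set_integral_diff(1)[OF int1 int2])
    fix x :: real assume "0 < ereal x"
    then have x: "0 < x" by simp
    define z where "z = x powr (- a)"
    have "(F has_real_derivative
        ((- a * (z / x)) * exp (- z) + exp (- z) * - (- a * (z / x)) * z) * ln x + 1 / x * (z * exp (- z))
          - exp (- z) * - (- a * (z / x)) / a) (at x)"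
      unfolding z_def F_def[abs_def]
      by (intro DERIV_mult DERIV_diff DERIV_cdivide DERIV_powr_neg[OF x] DERIV_chain2[OF DERIV_exp]
            DERIV_minus DERIV_ln_divide x)
    also have "((- a * (z / x)) * exp (- z) + exp (- z) * - (- a * (z / x)) * z) * ln x + 1 / x * (z * exp (- z))
          - exp (- z) * - (- a * (z / x)) / a
        = x powr (- a) * ln x * frechet_density a 1 x - ln x * frechet_density a 1 x"
      unfolding frechet_density_1[OF x] z_def using a_pos x by (simp add: field_simps)
    finally show "(F has_vector_derivative
        x powr (- a) * ln x * frechet_density a 1 x - ln x * frechet_density a 1 x) (at x)"
      by (simp add: has_real_derivative_iff_has_vector_derivative)
    show "isCont (\<lambda>x. x powr (- a) * ln x * frechet_density a 1 x - ln x * frechet_density a 1 x) x"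
      using x by (intro continuous_intros isCont_frechet_density) auto
  next
    show "((F \<circ> real_of_ereal) \<longlongrightarrow> 0) (at_right 0)"
      unfolding at_right_0_comp F_def using a_pos by real_asymp
    have "(F \<longlongrightarrow> - inverse a) at_top"
      unfolding F_def using a_pos by real_asymp
    then show "((F \<circ> real_of_ereal) \<longlongrightarrow> - 1 / a) (at_left \<infinity>)"
      unfolding ereal_tendsto_simps1 by (simp add: divide_inverse)
  qed simp
  finally show ?thesis by (simp only: diff_0_right)
qed

end

section \<open>Consistency along a filter\<close>

text \<open>For \<open>a\<close> in the given range, \<open>Psi\<close> at \<open>a\<close> converges to a number \<open>P a\<close>, and \<open>P\<close> is strictly
  decreasing with zero \<open>\<alpha>0\<close> by the Frechet moments above. Thus \<open>Psi\<close> is eventually positive at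
  points slightly below \<open>\<alpha>0\<close> and negative slightly above, which traps its zero. For the scale, the
  Lipschitz bound lets \<open>ln (neg_moment)\<close> at the estimated exponent be replaced by its value at
  \<open>\<alpha>0\<close>, which tends to \<open>ln 1 = 0\<close>. Nothing here is probabilistic: all limits are taken
  along one abstract filter.\<close>

lemma consistency_along_filter:
  fixes F :: "'c filter" and k :: "'c \<Rightarrow> nat" and y :: "'c \<Rightarrow> nat \<Rightarrow> real"
  assumes F: "F \<noteq> bot"
    and sample: "eventually (\<lambda>w. nonconstant_sample (k w) (y w)) F"
    and alphas: "0 < \<alpha>m" "\<alpha>m < \<alpha>0" "\<alpha>0 < \<alpha>p"
    and lim: "\<And>f. f \<in> F1 \<alpha>m \<alpha>p \<Longrightarrow> ((\<lambda>w. sample_mean (k w) (\<lambda>i. f (y w i)))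
                \<longlongrightarrow> (LBINT x:{0<..}. f x * frechet_density \<alpha>0 1 x)) F"
  shows "((\<lambda>w. real_of_ereal (alpha_hat (k w) (y w))) \<longlongrightarrow> \<alpha>0) F"
    and "((\<lambda>w. sigma_hat (k w) (y w)) \<longlongrightarrow> 1) F"
proof -
  define L where "L = (LBINT x:{0<..}. ln x * frechet_density \<alpha>0 1 x)"
  define D where "D a = (LBINT x:{0<..}. x powr (- a) * frechet_density \<alpha>0 1 x)" for a
  define N where "N a = (LBINT x:{0<..}. x powr (- a) * ln x * frechet_density \<alpha>0 1 x)" for a
  define P where "P a = 1 / a + N a / D a - L" for a
  define A where "A = {\<alpha>m<..<\<alpha>p}"
  have A0: "\<alpha>0 \<in> A" and A_pos: "\<And>a. a \<in> A \<Longrightarrow> 0 < a" using alphas by (auto simp: A_def)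
  have pos_sample: "eventually (\<lambda>w. positive_sample (k w) (y w)) F"
    using sample by eventually_elim (simp add: nonconstant_sample_def)
  have L_lim: "((\<lambda>w. mean_log (k w) (y w)) \<longlongrightarrow> L) F"
    unfolding mean_log_def L_def by (rule lim) (simp add: F1_def)
  have D_lim: "((\<lambda>w. neg_moment (k w) (y w) a) \<longlongrightarrow> D a) F" if "a \<in> A" for a
    unfolding neg_moment_def D_def by (rule lim) (use that in \<open>auto simp: F1_def A_def\<close>)
  have N_lim: "((\<lambda>w. neg_log_moment (k w) (y w) a) \<longlongrightarrow> N a) F" if "a \<in> A" for a
    unfolding neg_log_moment_def N_def by (rule lim) (use that in \<open>auto simp: F1_def A_def\<close>)
  have D_pos: "0 < D a" if "a \<in> A" for a
  proof -
    have "((\<lambda>w. exp (- a * mean_log (k w) (y w))) \<longlongrightarrow> exp (- a * L)) F"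
      by (intro tendsto_intros L_lim)
    then have "exp (- a * L) \<le> D a"
      by (rule tendsto_le[OF F D_lim[OF that]])
         (rule eventually_mono[OF pos_sample positive_sample.neg_moment_ge_exp])
    then show ?thesis by (rule less_le_trans[OF exp_gt_zero])
  qed
  have tilted_lim: "((\<lambda>w. tilted_log (k w) (y w) a) \<longlongrightarrow> N a / D a) F" if "a \<in> A" for a
    unfolding tilted_log_def using D_pos[OF that] by (intro tendsto_divide N_lim D_lim that) auto
  have Psi_lim: "((\<lambda>w. Psi (k w) (y w) a) \<longlongrightarrow> P a) F" if "a \<in> A" for a
    unfolding Psi_eq P_def by (intro tendsto_intros tilted_lim L_lim that)
  have P_zero: "P \<alpha>0 = 0"
    using frechet_neg_moment[of \<alpha>0] frechet_log_moment_diff[of \<alpha>0] alphas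
    by (simp add: P_def N_def D_def L_def)
  have P_less: "P b < P a" if "a \<in> A" "b \<in> A" "a < b" for a b
  proof -
    have "((\<lambda>w. Psi (k w) (y w) a - Psi (k w) (y w) b) \<longlongrightarrow> P a - P b) F"
      by (intro tendsto_intros Psi_lim that)
    then have "1 / a - 1 / b \<le> P a - P b"
    proof (rule tendsto_lowerbound[OF _ _ F])
      show "\<forall>\<^sub>F w in F. 1 / a - 1 / b \<le> Psi (k w) (y w) a - Psi (k w) (y w) b"
        using pos_sample by eventually_elim (use that in \<open>simp add: positive_sample.Psi_diff_ge\<close>)
    qed
    moreover have "1 / b < 1 / a"
      using that A_pos[OF that(1)] by (intro divide_strict_left_mono) auto
    ultimately show ?thesis by linarith
  qed
  show alpha_lim: "((\<lambda>w. real_of_ereal (alpha_hat (k w) (y w))) \<longlongrightarrow> \<alpha>0) F"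
  proof (rule order_tendstoI)
    fix c assume "c < \<alpha>0"
    \<comment> \<open>The point has to lie in the range of exponents where convergence is known.\<close>
    define a where "a = max c ((\<alpha>m + \<alpha>0) / 2)"
    have a: "a \<in> A" "a < \<alpha>0" "c \<le> a" using alphas \<open>c < \<alpha>0\<close> by (auto simp: a_def A_def less_max_iff_disj)
    then have "0 < P a" using P_less[of a \<alpha>0] A0 P_zero by simp
    from order_tendstoD(1)[OF Psi_lim[OF a(1)] this] sample
    show "\<forall>\<^sub>F w in F. c < real_of_ereal (alpha_hat (k w) (y w))"
      by eventually_elim (use nonconstant_sample.Psi_sign(1) A_pos a in fastforce)
  next
    fix c assume "\<alpha>0 < c"
    \<comment> \<open>As above, the minimum keeps the point inside the range of exponents.\<close>
    define a where "a = min c ((\<alpha>0 + \<alpha>p) / 2)"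
    have a: "a \<in> A" "\<alpha>0 < a" "a \<le> c" using alphas \<open>\<alpha>0 < c\<close> by (auto simp: a_def A_def min_less_iff_disj)
    then have "P a < 0" using P_less[of \<alpha>0 a] A0 P_zero by simp
    from order_tendstoD(2)[OF Psi_lim[OF a(1)] this] sample
    show "\<forall>\<^sub>F w in F. real_of_ereal (alpha_hat (k w) (y w)) < c"
      by eventually_elim (use nonconstant_sample.Psi_sign(2) A_pos a in fastforce)
  qed
  define a b where "a = (\<alpha>m + \<alpha>0) / 2" and "b = (\<alpha>0 + \<alpha>p) / 2"
  have ab: "a \<in> A" "b \<in> A" "a < \<alpha>0" "\<alpha>0 < b" using alphas by (auto simp: a_def b_def A_def)
  define h where "h w = ln (neg_moment (k w) (y w) (real_of_ereal (alpha_hat (k w) (y w))))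
                         - ln (neg_moment (k w) (y w) \<alpha>0)" for w
  have "(h \<longlongrightarrow> 0) F"
  proof (rule Lim_null_comparison)
    show "\<forall>\<^sub>F w in F. norm (h w) \<le> (\<bar>tilted_log (k w) (y w) a\<bar> + \<bar>tilted_log (k w) (y w) b\<bar>)
                  * \<bar>real_of_ereal (alpha_hat (k w) (y w)) - \<alpha>0\<bar>"
      using pos_sample order_tendstoD(1)[OF alpha_lim ab(3)] order_tendstoD(2)[OF alpha_lim ab(4)]
    proof eventually_elim
      case (elim w)
      then show ?case
        unfolding h_def real_norm_def using ab
        by (intro positive_sample.ln_neg_moment_Lipschitz) auto
    qed
    have "((\<lambda>w. (\<bar>tilted_log (k w) (y w) a\<bar> + \<bar>tilted_log (k w) (y w) b\<bar>)
                  * \<bar>real_of_ereal (alpha_hat (k w) (y w)) - \<alpha>0\<bar>)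
          \<longlongrightarrow> (\<bar>N a / D a\<bar> + \<bar>N b / D b\<bar>) * \<bar>\<alpha>0 - \<alpha>0\<bar>) F"
      by (intro tendsto_intros tilted_lim alpha_lim ab)
    then show "((\<lambda>w. (\<bar>tilted_log (k w) (y w) a\<bar> + \<bar>tilted_log (k w) (y w) b\<bar>)
                  * \<bar>real_of_ereal (alpha_hat (k w) (y w)) - \<alpha>0\<bar>) \<longlongrightarrow> 0) F"
      by simp
  qed
  moreover have "((\<lambda>w. ln (neg_moment (k w) (y w) \<alpha>0)) \<longlongrightarrow> ln 1) F"
    using D_lim[OF A0] frechet_neg_moment[of \<alpha>0] alphas by (intro tendsto_ln) (auto simp: D_def)
  ultimately have sum_lim: "((\<lambda>w. h w + ln (neg_moment (k w) (y w) \<alpha>0)) \<longlongrightarrow> 0 + ln 1) F"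
    by (rule tendsto_add)
  have "((\<lambda>w. exp (- 1 / real_of_ereal (alpha_hat (k w) (y w))
                         * (h w + ln (neg_moment (k w) (y w) \<alpha>0)))) \<longlongrightarrow> exp (- 1 / \<alpha>0 * (0 + ln 1))) F"
    using alphas
    by (intro tendsto_exp tendsto_mult tendsto_divide tendsto_const alpha_lim sum_lim) auto
  then have "((\<lambda>w. exp (- 1 / real_of_ereal (alpha_hat (k w) (y w))
                         * (h w + ln (neg_moment (k w) (y w) \<alpha>0)))) \<longlongrightarrow> 1) F"
    by simp
  then show "((\<lambda>w. sigma_hat (k w) (y w)) \<longlongrightarrow> 1) F"
  proof (rule Lim_transform_eventually)
    show "\<forall>\<^sub>F w in F. exp (- 1 / real_of_ereal (alpha_hat (k w) (y w))
                         * (h w + ln (neg_moment (k w) (y w) \<alpha>0))) = sigma_hat (k w) (y w)"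
      using sample
    proof eventually_elim
      case (elim w)
      interpret nonconstant_sample "k w" "y w" by fact
      show ?case
        unfolding sigma_hat_eq h_def powr_def using neg_moment_pos[of a_hat] by simp
    qed
  qed
qed

section \<open>Convergence in probability as a filter limit\<close>

text \<open>The filter of pairs (index, outcome) along which a property holds eventually iff it fails on
  events of vanishing probability. Limits along this filter are limits in probability, so the
  continuous mapping theorem and all limit arithmetic come from the general theory of filters. Covering
  the failure sets by measurable sets \<open>A n\<close>, instead of measuring them, keeps \<open>eventually\<close>
  monotone for arbitrary properties.\<close>

definition whp :: "(nat \<Rightarrow> 'a measure) \<Rightarrow> (nat \<times> 'a) filter" where
  "whp M = Abs_filter (\<lambda>P. \<exists>A. (\<forall>\<^sub>F n in sequentially. A n \<in> sets (M n) \<and> {\<omega> \<in> space (M n). \<not> P (n, \<omega>)} \<subseteq> A n)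
                               \<and> (\<lambda>n. measure (M n) (A n)) \<longlonglongrightarrow> 0)"

lemma eventually_whp:
  "eventually P (whp M) \<longleftrightarrow>
     (\<exists>A. (\<forall>\<^sub>F n in sequentially. A n \<in> sets (M n) \<and> {\<omega> \<in> space (M n). \<not> P (n, \<omega>)} \<subseteq> A n)
          \<and> (\<lambda>n. measure (M n) (A n)) \<longlonglongrightarrow> 0)"
  unfolding whp_def
proof (rule eventually_Abs_filter, unfold_locales, goal_cases)
  case 1
  show ?case by (intro exI[of _ "\<lambda>_. {}"]) auto
next
  case (2 P Q)
  then obtain A B
    where A: "\<forall>\<^sub>F n in sequentially. A n \<in> sets (M n) \<and> {\<omega> \<in> space (M n). \<not> P (n, \<omega>)} \<subseteq> A n"
        "(\<lambda>n. measure (M n) (A n)) \<longlonglongrightarrow> 0"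
      and B: "\<forall>\<^sub>F n in sequentially. B n \<in> sets (M n) \<and> {\<omega> \<in> space (M n). \<not> Q (n, \<omega>)} \<subseteq> B n"
        "(\<lambda>n. measure (M n) (B n)) \<longlonglongrightarrow> 0" by blast
  show ?case
  proof (intro exI[of _ "\<lambda>n. A n \<union> B n"] conjI)
    show "\<forall>\<^sub>F n in sequentially. A n \<union> B n \<in> sets (M n)
        \<and> {\<omega> \<in> space (M n). \<not> (P (n, \<omega>) \<and> Q (n, \<omega>))} \<subseteq> A n \<union> B n"
      using A(1) B(1) by eventually_elim auto
    show "(\<lambda>n. measure (M n) (A n \<union> B n)) \<longlonglongrightarrow> 0"
    proof (rule tendsto_sandwich[where f = "\<lambda>_. 0"])
      show "(\<lambda>n. measure (M n) (A n) + measure (M n) (B n)) \<longlonglongrightarrow> 0"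
        using tendsto_add[OF A(2) B(2)] by simp
      show "\<forall>\<^sub>F n in sequentially. measure (M n) (A n \<union> B n) \<le> measure (M n) (A n) + measure (M n) (B n)"
        using A(1) B(1) by eventually_elim (simp add: measure_Un_le)
    qed auto
  qed
next
  case (3 P Q)
  from 3(2) obtain A
    where A: "\<forall>\<^sub>F n in sequentially. A n \<in> sets (M n) \<and> {\<omega> \<in> space (M n). \<not> P (n, \<omega>)} \<subseteq> A n"
        "(\<lambda>n. measure (M n) (A n)) \<longlonglongrightarrow> 0" by blast
  from A(1) have "\<forall>\<^sub>F n in sequentially. A n \<in> sets (M n) \<and> {\<omega> \<in> space (M n). \<not> Q (n, \<omega>)} \<subseteq> A n"
    by eventually_elim (use 3(1) in blast)
  with A(2) show ?case by blast
qed

context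
  fixes M :: "nat \<Rightarrow> 'a measure"
  assumes prob: "\<And>n. n \<ge> 1 \<Longrightarrow> prob_space (M n)"
begin

text \<open>An event that never happens fails on the whole space, which has probability one.\<close>

lemma whp_neq_bot: "whp M \<noteq> bot"
proof
  assume "whp M = bot"
  then have "eventually (\<lambda>_. False) (whp M)" by simp
  then obtain A where A: "\<forall>\<^sub>F n in sequentially. A n \<in> sets (M n) \<and> space (M n) \<subseteq> A n"
      "(\<lambda>n. measure (M n) (A n)) \<longlonglongrightarrow> 0"
    unfolding eventually_whp by auto
  from A(1) eventually_ge_at_top[of 1] have "\<forall>\<^sub>F n in sequentially. measure (M n) (A n) = 1"
  proof eventually_elim
    case (elim n)
    then have "A n = space (M n)" using sets.sets_into_space by blast
    with elim show ?case using prob_space.prob_space[OF prob] by simp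
  qed
  then have "(\<lambda>n. measure (M n) (A n)) \<longlonglongrightarrow> 1" by (simp add: tendsto_eventually)
  from LIMSEQ_unique[OF this A(2)] show False by simp
qed

text \<open>Weak convergence to a constant is convergence in probability: the limiting distribution function
  jumps only at \<open>c\<close>, so the distribution functions converge at \<open>c - e\<close> to \<open>0\<close> and at
  \<open>c + e/2\<close> to \<open>1\<close>.\<close>

lemma weak_conv_m_return_imp_tendsto_whp:
  assumes Y: "\<And>n. n \<ge> 1 \<Longrightarrow> Y n \<in> borel_measurable (M n)"
    and conv: "weak_conv_m (\<lambda>n. distr (M n) borel (Y n)) (return borel c)"
  shows "((\<lambda>(n, \<omega>). Y n \<omega>) \<longlongrightarrow> c) (whp M)"
proof (rule tendstoI)
  fix e :: real assume e: "0 < e"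
  have cdf_c: "cdf (return borel c) x = (if c \<le> x then 1 else 0)" for x
    by (simp add: cdf_def measure_return)
  have lim: "(\<lambda>n. measure (M n) {\<omega> \<in> space (M n). Y n \<omega> \<le> x}) \<longlonglongrightarrow> (if c \<le> x then 1 else 0)"
    if "x \<noteq> c" for x
  proof -
    have "\<forall>\<^sub>F u in nhds x. (c \<le> u) = (c \<le> x)"
    proof (cases "x < c")
      case True
      then show ?thesis using eventually_nhds_in_open[of "{..<c}" x] by (auto elim: eventually_mono)
    next
      case False
      with that show ?thesis
        using eventually_nhds_in_open[of "{c<..}" x] by (auto elim: eventually_mono)
    qed
    then have "\<forall>\<^sub>F u in nhds x. cdf (return borel c) u = (if c \<le> x then 1 else 0)"
      by eventually_elim (simp add: cdf_c)
    then have "isCont (cdf (return borel c)) x"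
      using isCont_cong[of "cdf (return borel c)" "\<lambda>_. if c \<le> x then 1 else 0" x] by simp
    with conv have "(\<lambda>n. cdf (distr (M n) borel (Y n)) x) \<longlonglongrightarrow> (if c \<le> x then 1 else 0)"
      unfolding weak_conv_m_def weak_conv_def cdf_c by blast
    then show ?thesis
    proof (rule Lim_transform_eventually)
      show "\<forall>\<^sub>F n in sequentially. cdf (distr (M n) borel (Y n)) x = measure (M n) {\<omega> \<in> space (M n). Y n \<omega> \<le> x}"
        using eventually_ge_at_top[of 1]
      proof eventually_elim
        case (elim n)
        have "Y n -` {..x} \<inter> space (M n) = {\<omega> \<in> space (M n). Y n \<omega> \<le> x}" by auto
        with Y[OF elim] show ?case by (simp add: cdf_def measure_distr)
      qed
    qed
  qed
  \<comment> \<open>The right bound is \<open>c + e/2\<close>, because \<open>Y n \<omega> \<le> c + e\<close> would not give a strict inequality.\<close>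
  define A where "A n = {\<omega> \<in> space (M n). Y n \<omega> \<le> c - e} \<union> {\<omega> \<in> space (M n). \<not> Y n \<omega> \<le> c + e / 2}" for n
  show "\<forall>\<^sub>F w in whp M. dist (case w of (n, \<omega>) \<Rightarrow> Y n \<omega>) c < e"
    unfolding eventually_whp
  proof (intro exI[of _ A] conjI)
    show "\<forall>\<^sub>F n in sequentially. A n \<in> sets (M n)
        \<and> {\<omega> \<in> space (M n). \<not> dist (case (n, \<omega>) of (n, \<omega>) \<Rightarrow> Y n \<omega>) c < e} \<subseteq> A n"
      using eventually_ge_at_top[of 1]
    proof eventually_elim
      case (elim n)
      note [measurable] = Y[OF elim]
      have "A n \<in> sets (M n)" unfolding A_def by measurable
      moreover have "{\<omega> \<in> space (M n). \<not> dist (case (n, \<omega>) of (n, \<omega>) \<Rightarrow> Y n \<omega>) c < e} \<subseteq> A n"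
        using e by (auto simp: A_def dist_real_def abs_if split: if_splits)
      ultimately show ?case ..
    qed
    show "(\<lambda>n. measure (M n) (A n)) \<longlonglongrightarrow> 0"
    proof (rule tendsto_sandwich[where f = "\<lambda>_. 0"])
      show "(\<lambda>n. measure (M n) {\<omega> \<in> space (M n). Y n \<omega> \<le> c - e}
               + (1 - measure (M n) {\<omega> \<in> space (M n). Y n \<omega> \<le> c + e / 2})) \<longlonglongrightarrow> 0"
        using tendsto_add[OF lim[of "c - e"] tendsto_diff[OF tendsto_const[of 1] lim[of "c + e / 2"]]] e
        by simp
      show "\<forall>\<^sub>F n in sequentially. measure (M n) (A n) \<le> measure (M n) {\<omega> \<in> space (M n). Y n \<omega> \<le> c - e}
               + (1 - measure (M n) {\<omega> \<in> space (M n). Y n \<omega> \<le> c + e / 2})"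
        using eventually_ge_at_top[of 1]
      proof eventually_elim
        case (elim n)
        interpret prob_space "M n" by (rule prob[OF elim])
        note [measurable] = Y[OF elim]
        have "prob {\<omega> \<in> space (M n). \<not> Y n \<omega> \<le> c + e / 2} = 1 - prob {\<omega> \<in> space (M n). Y n \<omega> \<le> c + e / 2}"
          by (rule prob_neg) measurable
        moreover have "prob (A n) \<le> prob {\<omega> \<in> space (M n). Y n \<omega> \<le> c - e} + prob {\<omega> \<in> space (M n). \<not> Y n \<omega> \<le> c + e / 2}"
          unfolding A_def by (rule measure_Un_le) measurable
        ultimately show ?case by simp
      qed
    qed auto
  qed
qed

text \<open>Split the expectation of \<open>\<bar>f (Z n) - f c\<bar>\<close>: outside a set of vanishing probability the integrand
  is small, and on that set it is bounded.\<close>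

lemma tendsto_whp_imp_weak_conv_bc:
  fixes Z :: "nat \<Rightarrow> 'a \<Rightarrow> 'b::topological_space"
  assumes Z: "\<And>n. n \<ge> 1 \<Longrightarrow> Z n \<in> borel_measurable (M n)"
    and lim: "((\<lambda>(n, \<omega>). Z n \<omega>) \<longlongrightarrow> c) (whp M)"
  shows "weak_conv_bc (\<lambda>n. distr (M n) borel (Z n)) (return borel c)"
  unfolding weak_conv_bc_def
proof (intro allI impI)
  fix f :: "'b \<Rightarrow> real"
  assume f: "continuous_on UNIV f \<and> bounded (range f)"
  then have f_borel[measurable]: "f \<in> borel_measurable borel"
    by (intro borel_measurable_continuous_onI) auto
  from f obtain B where B: "\<And>x. \<bar>f x\<bar> \<le> B" by (auto simp: bounded_iff)
  have f_lim: "((\<lambda>(n, \<omega>). f (Z n \<omega>)) \<longlongrightarrow> f c) (whp M)"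
    using continuous_on_tendsto_compose[OF conjunct1[OF f] lim] by (simp add: case_prod_unfold)
  have "(\<lambda>n. integral\<^sup>L (distr (M n) borel (Z n)) f) \<longlonglongrightarrow> f c"
  proof (rule tendstoI)
    fix e :: real assume e: "0 < e"
    have "\<forall>\<^sub>F w in whp M. dist (case w of (n, \<omega>) \<Rightarrow> f (Z n \<omega>)) (f c) < e / 2"
      using tendstoD[OF f_lim, of "e / 2"] e by simp
    then obtain A where A: "\<forall>\<^sub>F n in sequentially. A n \<in> sets (M n)
            \<and> {\<omega> \<in> space (M n). \<not> \<bar>f (Z n \<omega>) - f c\<bar> < e / 2} \<subseteq> A n"
        "(\<lambda>n. measure (M n) (A n)) \<longlonglongrightarrow> 0"
      unfolding eventually_whp by (auto simp: dist_real_def)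
    have "(\<lambda>n. 2 * B * measure (M n) (A n)) \<longlonglongrightarrow> 2 * B * 0"
      by (intro tendsto_intros A)
    then have "\<forall>\<^sub>F n in sequentially. 2 * B * measure (M n) (A n) < e / 2"
      using e by (intro order_tendstoD(2)) auto
    with A(1) eventually_ge_at_top[of 1]
    show "\<forall>\<^sub>F n in sequentially. dist (integral\<^sup>L (distr (M n) borel (Z n)) f) (f c) < e"
    proof eventually_elim
      case (elim n)
      interpret prob_space "M n" using elim by (intro prob)
      have Zn[measurable]: "Z n \<in> borel_measurable (M n)" using elim by (intro Z)
      have [measurable]: "A n \<in> sets (M n)" using elim by simp
      have int: "integrable (M n) (\<lambda>\<omega>. f (Z n \<omega>))"
        by (rule integrable_const_bound[of _ B]) (use B in auto)
      have "integral\<^sup>L (distr (M n) borel (Z n)) f - f c = (\<integral>\<omega>. f (Z n \<omega>) - f c \<partial>M n)"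
        using int by (simp add: integral_distr prob_space)
      also have "\<bar>\<dots>\<bar> \<le> (\<integral>\<omega>. \<bar>f (Z n \<omega>) - f c\<bar> \<partial>M n)"
        by (rule integral_abs_bound)
      also have "\<dots> \<le> (\<integral>\<omega>. e / 2 + 2 * B * indicator (A n) \<omega> \<partial>M n)"
      proof (rule integral_mono)
        fix \<omega> assume \<omega>: "\<omega> \<in> space (M n)"
        have "\<bar>f (Z n \<omega>) - f c\<bar> \<le> 2 * B" using B[of "Z n \<omega>"] B[of c] by linarith
        with elim \<omega> e show "\<bar>f (Z n \<omega>) - f c\<bar> \<le> e / 2 + 2 * B * indicator (A n) \<omega>"
          by (cases "\<omega> \<in> A n") auto
      next
        show "integrable (M n) (\<lambda>\<omega>. e / 2 + 2 * B * indicator (A n) \<omega>)"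
          by (intro Bochner_Integration.integrable_add integrable_mult_right integrable_const
                integrable_real_indicator) (simp_all add: emeasure_eq_measure)
      qed (use int in auto)
      also have "\<dots> = e / 2 + 2 * B * prob (A n)"
        by (subst Bochner_Integration.integral_add)
           (auto simp: prob_space emeasure_eq_measure intro!: integrable_mult_right integrable_real_indicator)
      finally show ?case using elim by (simp add: dist_real_def)
    qed
  qed
  then show "(\<lambda>n. integral\<^sup>L (distr (M n) borel (Z n)) f) \<longlonglongrightarrow> integral\<^sup>L (return borel c) f"
    by (simp add: integral_return)
qed

end

section \<open>Measurability of the estimators\<close>

lemma sample_mean_measurable:
  assumes "\<And>i. i \<in> {1..k} \<Longrightarrow> (\<lambda>\<omega>. Y i \<omega>) \<in> borel_measurable M"
  shows "(\<lambda>\<omega>. sample_mean k (\<lambda>i. Y i \<omega>)) \<in> borel_measurable M"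
  unfolding sample_mean_def using assms by (intro borel_measurable_divide borel_measurable_sum) auto

context
  fixes M :: "'a measure" and k :: nat and X :: "nat \<Rightarrow> 'a \<Rightarrow> real"
  assumes k: "1 \<le> k"
    and meas: "\<And>i. i \<in> {1..k} \<Longrightarrow> X i \<in> borel_measurable M"
    and pos: "\<And>i \<omega>. i \<in> {1..k} \<Longrightarrow> \<omega> \<in> space M \<Longrightarrow> 0 < X i \<omega>"
begin

lemma all_equal_sets: "{\<omega> \<in> space M. all_equal k (\<lambda>i. X i \<omega>)} \<in> sets M"
  unfolding all_equal_def using k
  by (intro sets.sets_Collect_finite_All' borel_measurable_eq meas) auto

text \<open>For \<open>c > 0\<close>, the estimator is below \<open>c\<close> where the measurable function \<open>Psi\<close> is negative at
  \<open>c\<close>, and on the event that all observations agree, because \<open>real_of_ereal \<infinity> = 0\<close>.\<close>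

lemma real_alpha_hat_measurable:
  "(\<lambda>\<omega>. real_of_ereal (alpha_hat k (\<lambda>i. X i \<omega>))) \<in> borel_measurable M"
proof (rule borel_measurable_iff_less[THEN iffD2], rule allI)
  fix c :: real
  have X_sample: "positive_sample k (\<lambda>i. X i \<omega>)" if "\<omega> \<in> space M" for \<omega>
    using k pos that by unfold_locales
  show "{\<omega> \<in> space M. real_of_ereal (alpha_hat k (\<lambda>i. X i \<omega>)) < c} \<in> sets M"
  proof (cases "0 < c")
    case True
    have Psi_meas: "(\<lambda>\<omega>. Psi k (\<lambda>i. X i \<omega>) c) \<in> borel_measurable M"
      unfolding Psi_def
      by (intro borel_measurable_diff borel_measurable_add borel_measurable_divide borel_measurable_const
            sample_mean_measurable borel_measurable_times borel_measurable_ln powr_real_measurable meas)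
    have "real_of_ereal (alpha_hat k (\<lambda>i. X i \<omega>)) < c
        \<longleftrightarrow> all_equal k (\<lambda>i. X i \<omega>) \<or> Psi k (\<lambda>i. X i \<omega>) c < 0" if "\<omega> \<in> space M" for \<omega>
    proof (cases "all_equal k (\<lambda>i. X i \<omega>)")
      case True
      with \<open>0 < c\<close> show ?thesis by (simp add: alpha_hat_def)
    next
      case False
      then interpret nonconstant_sample k "\<lambda>i. X i \<omega>"
        using X_sample[OF that] by (simp add: nonconstant_sample_def nonconstant_sample_axioms_def)
      show ?thesis using False Psi_sign(2)[OF \<open>0 < c\<close>] by simp
    qed
    then have "{\<omega> \<in> space M. real_of_ereal (alpha_hat k (\<lambda>i. X i \<omega>)) < c}
        = {\<omega> \<in> space M. all_equal k (\<lambda>i. X i \<omega>)} \<union> {\<omega> \<in> space M. Psi k (\<lambda>i. X i \<omega>) c < 0}"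
      by auto
    moreover have "{\<omega> \<in> space M. Psi k (\<lambda>i. X i \<omega>) c < 0} \<in> sets M"
      using Psi_meas by (intro borel_measurable_less) auto
    ultimately show ?thesis using all_equal_sets by auto
  next
    case False
    have "0 \<le> real_of_ereal (alpha_hat k (\<lambda>i. X i \<omega>))" if "\<omega> \<in> space M" for \<omega>
    proof (cases "all_equal k (\<lambda>i. X i \<omega>)")
      case True
      then show ?thesis by (simp add: alpha_hat_def)
    next
      case False
      then interpret nonconstant_sample k "\<lambda>i. X i \<omega>"
        using X_sample[OF that] by (simp add: nonconstant_sample_def nonconstant_sample_axioms_def)
      show ?thesis using a_hat(1) by simp
    qed
    with False have "{\<omega> \<in> space M. real_of_ereal (alpha_hat k (\<lambda>i. X i \<omega>)) < c} = {}" by force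
    then show ?thesis by (simp only: sets.empty_sets)
  qed
qed

lemma alpha_hat_measurable: "(\<lambda>\<omega>. alpha_hat k (\<lambda>i. X i \<omega>)) \<in> borel_measurable M"
proof -
  have eq: "alpha_hat k (\<lambda>i. X i \<omega>) =
      (if all_equal k (\<lambda>i. X i \<omega>) then \<infinity> else ereal (real_of_ereal (alpha_hat k (\<lambda>i. X i \<omega>))))" for \<omega>
    by (simp add: alpha_hat_def)
  show ?thesis
    by (subst eq, rule measurable_If[OF _ _ all_equal_sets])
       (auto intro: borel_measurable_ereal real_alpha_hat_measurable)
qed

lemma sigma_hat_measurable: "(\<lambda>\<omega>. sigma_hat k (\<lambda>i. X i \<omega>)) \<in> borel_measurable M"
  unfolding sigma_hat_def Let_def using k
  by (intro measurable_If[OF _ _ all_equal_sets] powr_real_measurable sample_mean_measurable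
        borel_measurable_divide borel_measurable_uminus borel_measurable_const
        real_alpha_hat_measurable meas) auto

end

section \<open>Maximum likelihood estimation in the Frechet family\<close>

lemma F1_measurable: "f \<in> F1 a b \<Longrightarrow> f \<in> borel_measurable borel"
  unfolding F1_def by auto

theorem theorem2p3:
  fixes M :: "nat \<Rightarrow> 'a measure"
    and X :: "nat \<Rightarrow> nat \<Rightarrow> 'a \<Rightarrow> real"
    and k :: "nat \<Rightarrow> nat"
    and \<sigma> :: "nat \<Rightarrow> real"
    and \<alpha>m \<alpha>0 \<alpha>p :: real
  assumes prob: "\<And>n. n \<ge> 1 \<Longrightarrow> prob_space (M n)"
    and meas: "\<And>n i. n \<ge> 1 \<Longrightarrow> i \<in> {1..k n} \<Longrightarrow> X n i \<in> borel_measurable (M n)"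
    and pos: "\<And>n i \<omega>. n \<ge> 1 \<Longrightarrow> i \<in> {1..k n} \<Longrightarrow> \<omega> \<in> space (M n) \<Longrightarrow> X n i \<omega> > 0"
    and k_ge: "\<And>n. n \<ge> 1 \<Longrightarrow> k n \<ge> 2"
    and k_lim: "filterlim k at_top sequentially"
    and not_all_equal:
      "(\<lambda>n. measure (M n) {\<omega> \<in> space (M n). all_equal (k n) (\<lambda>i. X n i \<omega>)}) \<longlonglongrightarrow> 0"
    and alphas: "0 < \<alpha>m" "\<alpha>m < \<alpha>0" "\<alpha>0 < \<alpha>p"
    and sigma_pos: "\<And>n. n \<ge> 1 \<Longrightarrow> \<sigma> n > 0"
    and F1_conv: "\<And>f. f \<in> F1 \<alpha>m \<alpha>p \<Longrightarrow>
      weak_conv_m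
        (\<lambda>n. distr (M n) borel (\<lambda>\<omega>. sample_mean (k n) (\<lambda>i. f (X n i \<omega> / \<sigma> n))))
        (return borel (LBINT x:{0<..}. f x * frechet_density \<alpha>0 1 x))"
  shows "(\<forall>n\<ge>1. \<forall>\<omega>\<in>space (M n). \<not> all_equal (k n) (\<lambda>i. X n i \<omega>) \<longrightarrow>
           (\<forall>\<theta>. is_arg_max (\<lambda>(\<alpha>, s). frechet_log_likelihood (k n) (\<lambda>i. X n i \<omega>) \<alpha> s)
                   (\<lambda>\<theta>. \<theta> \<in> {0<..} \<times> {0<..}) \<theta> \<longleftrightarrow>
                 \<theta> = (real_of_ereal (alpha_hat (k n) (\<lambda>i. X n i \<omega>)),
                      sigma_hat (k n) (\<lambda>i. X n i \<omega>))))
         \<and> weak_conv_bc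
           (\<lambda>n. distr (M n) borel
              (\<lambda>\<omega>. (alpha_hat (k n) (\<lambda>i. X n i \<omega>), sigma_hat (k n) (\<lambda>i. X n i \<omega>) / \<sigma> n)))
           (return borel (ereal \<alpha>0, 1))"
proof (intro conjI allI ballI impI)
  have k1: "1 \<le> k n" if "n \<ge> 1" for n using k_ge[OF that] by simp
  have X_sample: "positive_sample (k n) (\<lambda>i. X n i \<omega>)" if "n \<ge> 1" "\<omega> \<in> space (M n)" for n \<omega>
    using k1 pos that by unfold_locales auto
  have X_nonconst: "nonconstant_sample (k n) (\<lambda>i. X n i \<omega>)"
    if "n \<ge> 1" "\<omega> \<in> space (M n)" "\<not> all_equal (k n) (\<lambda>i. X n i \<omega>)" for n \<omega>
    using X_sample that by (simp add: nonconstant_sample_def nonconstant_sample_axioms_def)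
  {
    fix n \<omega> \<theta>
    assume "n \<ge> 1" "\<omega> \<in> space (M n)" "\<not> all_equal (k n) (\<lambda>i. X n i \<omega>)"
    then interpret nonconstant_sample "k n" "\<lambda>i. X n i \<omega>" by (rule X_nonconst)
    show "is_arg_max (\<lambda>(\<alpha>, s). frechet_log_likelihood (k n) (\<lambda>i. X n i \<omega>) \<alpha> s)
            (\<lambda>\<theta>. \<theta> \<in> {0<..} \<times> {0<..}) \<theta> \<longleftrightarrow>
          \<theta> = (real_of_ereal (alpha_hat (k n) (\<lambda>i. X n i \<omega>)), sigma_hat (k n) (\<lambda>i. X n i \<omega>))"
      by (rule is_arg_max_log_likelihood)
  }
  define y where "y w = (\<lambda>i. X (fst w) i (snd w) / \<sigma> (fst w))" for w
  have nonconst: "\<forall>\<^sub>F w in whp M. fst w \<ge> 1 \<and> nonconstant_sample (k (fst w)) (\<lambda>i. X (fst w) i (snd w))"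
    unfolding eventually_whp
  proof (intro exI[of _ "\<lambda>n. {\<omega> \<in> space (M n). all_equal (k n) (\<lambda>i. X n i \<omega>)}"] conjI not_all_equal)
    show "\<forall>\<^sub>F n in sequentially. {\<omega> \<in> space (M n). all_equal (k n) (\<lambda>i. X n i \<omega>)} \<in> sets (M n)
        \<and> {\<omega> \<in> space (M n). \<not> (fst (n, \<omega>) \<ge> 1
             \<and> nonconstant_sample (k (fst (n, \<omega>))) (\<lambda>i. X (fst (n, \<omega>)) i (snd (n, \<omega>))))}
          \<subseteq> {\<omega> \<in> space (M n). all_equal (k n) (\<lambda>i. X n i \<omega>)}"
      using eventually_ge_at_top[of 1]
    proof eventually_elim
      case (elim n)
      have "{\<omega> \<in> space (M n). all_equal (k n) (\<lambda>i. X n i \<omega>)} \<in> sets (M n)"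
        by (rule all_equal_sets) (use k1 meas pos elim in auto)
      with X_nonconst elim show ?case by auto
    qed
  qed
  have y_nonconst: "\<forall>\<^sub>F w in whp M. nonconstant_sample (k (fst w)) (y w)"
    using nonconst
  proof eventually_elim
    case (elim w)
    then interpret nonconstant_sample "k (fst w)" "\<lambda>i. X (fst w) i (snd w)" by simp
    show ?case
      unfolding y_def using elim sigma_pos[of "fst w"] k_ge_1 x_pos not_all_equal
      by unfold_locales (auto simp: all_equal_scale)
  qed
  have lim: "((\<lambda>w. sample_mean (k (fst w)) (\<lambda>i. f (y w i)))
               \<longlongrightarrow> (LBINT x:{0<..}. f x * frechet_density \<alpha>0 1 x)) (whp M)" if f: "f \<in> F1 \<alpha>m \<alpha>p" for f
  proof -
    have "(\<lambda>\<omega>. sample_mean (k n) (\<lambda>i. f (X n i \<omega> / \<sigma> n))) \<in> borel_measurable (M n)" if "n \<ge> 1" for n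
      using meas[OF that] F1_measurable[OF f]
      by (intro sample_mean_measurable measurable_compose[OF _ F1_measurable[OF f]]) auto
    from weak_conv_m_return_imp_tendsto_whp[OF prob this F1_conv[OF f]] show ?thesis
      by (simp add: y_def case_prod_unfold)
  qed
  note consistent = consistency_along_filter[OF whp_neq_bot[OF prob] y_nonconst alphas lim]
  have hats: "\<forall>\<^sub>F w in whp M.
      (ereal (real_of_ereal (alpha_hat (k (fst w)) (y w))), sigma_hat (k (fst w)) (y w))
      = (alpha_hat (k (fst w)) (\<lambda>i. X (fst w) i (snd w)),
         sigma_hat (k (fst w)) (\<lambda>i. X (fst w) i (snd w)) / \<sigma> (fst w))"
    using nonconst
  proof eventually_elim
    case (elim w)
    then interpret nonconstant_sample "k (fst w)" "\<lambda>i. X (fst w) i (snd w)" by simp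
    have s: "0 < \<sigma> (fst w)" using elim sigma_pos by simp
    show ?case
      unfolding y_def alpha_hat_scale[OF positive_sample_axioms s]
        sigma_hat_scale[OF nonconstant_sample_axioms s]
      using a_hat(3) by simp
  qed
  have "((\<lambda>w. (ereal (real_of_ereal (alpha_hat (k (fst w)) (y w))), sigma_hat (k (fst w)) (y w)))
      \<longlongrightarrow> (ereal \<alpha>0, 1)) (whp M)"
    by (intro tendsto_Pair tendsto_ereal consistent)
  from Lim_transform_eventually[OF this hats]
  have "((\<lambda>(n, \<omega>). (alpha_hat (k n) (\<lambda>i. X n i \<omega>), sigma_hat (k n) (\<lambda>i. X n i \<omega>) / \<sigma> n))
      \<longlongrightarrow> (ereal \<alpha>0, 1)) (whp M)"
    by (simp add: case_prod_unfold)
  then show "weak_conv_bc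
           (\<lambda>n. distr (M n) borel
              (\<lambda>\<omega>. (alpha_hat (k n) (\<lambda>i. X n i \<omega>), sigma_hat (k n) (\<lambda>i. X n i \<omega>) / \<sigma> n)))
           (return borel (ereal \<alpha>0, 1))"
  proof (rule tendsto_whp_imp_weak_conv_bc[OF prob, rotated -1])
    fix n :: nat assume n: "n \<ge> 1"
    show "(\<lambda>\<omega>. (alpha_hat (k n) (\<lambda>i. X n i \<omega>), sigma_hat (k n) (\<lambda>i. X n i \<omega>) / \<sigma> n)) \<in> borel_measurable (M n)"
      using n k1 meas pos
      by (intro borel_measurable_Pair borel_measurable_divide borel_measurable_const
            alpha_hat_measurable sigma_hat_measurable) auto
  qed
qed

end
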